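(* Let $m\ge 1$ be an integer, $h>0$, and $A,A_d\in\mathbb{R}^{m\times m}$. Consider the time-delay system $$\dot{x}(t)=Ax(t)+A_dx(t-h),\qquad t\ge 0,\qquad x_0=\varphi\in\mathcal{C}_{pw}(-h,0;\mathbb{R}^m),$$ and assume that the Lyapunov condition holds, i.e. the matrix $N$ defined in the context is nonsingular. If there exists $n\in\mathbb{N}$ such that the matrix $\mathbf{P}_n$ defined in the context is not positive definite, then the system is not exponentially stable. Moreover, if $\mathbf{P}_n$ is not positive definite for some order $n$, then $\mathbf{P}_{n+1}$ is not positive definite either.
   Context: Notation. $|\cdot|$ is the Euclidean norm; $\otimes$ is the Kronecker product; $\mathrm{vec}$ stacks the columns of a matrix and $\mathrm{vec}^{-1}$ is its inverse. $\mathcal{C}_{pw}(-h,0;\mathbb{R}^m)$ is the set of piecewise continuous functions from $[-h,0]$ to $\mathbb{R}^m$, with norm $\|\varphi\|=\sup_{[-h,0]}|\varphi(\tau)|$; $x_t(\tau)=x(t+\tau)$ for $\tau\in[-h,0]$. In symmetric block matrices, $\ast$ denotes the transpose of the symmetric block. Exponential stability: there exist $\kappa\ge 1$, $\alpha>0$ such that $\|x_t\|\le\kappa e^{-\alpha t}\|x_0\|$ for all $t\ge 0$ and all $x_0\in\mathcal{C}_{pw}(-h,0;\mathbb{R}^m)$. Lyapunov matrix. Let $$M=\begin{bmatrix}A^\top\otimes I_m & A_d^\top\otimes I_m\\ -I_m\otimes A_d^\top & -I_m\otimes A^\top\end{bmatrix},$$ $$N=\begin{bmatrix}A^\top\otimes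 I_m+I_m\otimes A^\top & A_d^\top\otimes I_m\\ I_{m^2}&0\end{bmatrix}+\begin{bmatrix}I_m\otimes A_d^\top&0\\0&-I_{m^2}\end{bmatrix}e^{hM}.$$ When $N$ is nonsingular, $U:[-h,h]\to\mathbb{R}^{m\times m}$ is defined by $U(\tau)=\mathrm{vec}^{-1}(\mathcal{U}(\tau))$ with $$\mathcal{U}(\tau)=\begin{bmatrix}I_{m^2}&0\end{bmatrix}e^{\tau M}N^{-1}\begin{bmatrix}-\mathrm{vec}(I_m)\\0\end{bmatrix}\ (\tau\ge 0),\qquad \mathcal{U}(\tau)=\begin{bmatrix}0&I_{m^2}\end{bmatrix}e^{(h+\tau)M}N^{-1}\begin{bmatrix}-\mathrm{vec}(I_m)\\0\end{bmatrix}\ (\tau<0).$$ Legendre polynomials on $[-h,0]$: $l_k(\tau)=(-1)^k\sum_{j=0}^k(-1)^j\binom{k}{j}\binom{k+j}{j}\left(\frac{\tau+h}{h}\right)^j$, $k\in\mathbb{N}$, and $\ell_n(\tau)=\begin{bmatrix}l_0(\tau)I_m&\cdots&l_{n-1}(\tau)I_m\end{bmatrix}^\top\in\mathbb{R}^{nm\times m}$. Let $\mathbf{I}_n=\mathrm{diag}\left(\frac1h,\frac3h,\dots,\frac{2n-1}{h}\right)\otimes I_m$. Matrix $\mathbf{P}_n$: $$\mathbf{P}_n=\begin{bmatrix}U(0)&\mathbf{Q}_n\\ \ast&\mathbf{T}_n+\mathbf{I}_n^{-1}\end{bmatrix},\qquad \mathbf{Q}_n=\int_{-h}^0U^\top(h+\tau)A_d\,\ell_n^\top(\tau)\,d\tau,$$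 $$\mathbf{T}_n=\int_{-h}^0\int_{-h}^0\ell_n(\tau_1)A_d^\top U(\tau_1-\tau_2)A_d\,\ell_n^\top(\tau_2)\,d\tau_1d\tau_2.$$ For $n=0$ the blocks involving $\ell_n$ are empty and $\mathbf{P}_0=U(0)$. *)

theory Defs
  imports "HOL-Analysis.Analysis"
begin

section \<open>Matrix preliminaries\<close>

text \<open>
  The power and exponential are with respect to the matrix product \<open>**\<close>; the type-class
  operations \<open>^\<close> and \<open>exp\<close> do not apply here (multiplication on vectors is componentwise).
\<close>

primrec mpow :: "real^'k^'k \<Rightarrow> nat \<Rightarrow> real^'k^'k" where
  "mpow X 0 = mat 1"
| "mpow X (Suc i) = X ** mpow X i"

definition mexp :: "real^'k^'k \<Rightarrow> real^'k^'k" where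
  "mexp X = (\<Sum>i. (1 / fact i) *\<^sub>R mpow X i)"

text \<open>
  Vectors of length \<open>m\<^sup>2\<close> are indexed by pairs \<open>(j, i)\<close>, with \<open>j\<close> the column (block) index and
  \<open>i\<close> the row index, so that \<open>vec_of\<close> stacks columns and
  \<open>vec_of (A ** X ** B) = kron (transpose B) A *v vec_of X\<close>.
\<close>

definition kron :: "real^'m^'m \<Rightarrow> real^'m^'m \<Rightarrow> real^('m \<times> 'm)^('m \<times> 'm)" where
  "kron A B = (\<chi> p q. A $ fst p $ fst q * B $ snd p $ snd q)"

definition vec_of :: "real^'m^'m \<Rightarrow> real^('m \<times> 'm)" where
  "vec_of X = (\<chi> p. X $ snd p $ fst p)"

definition unvec :: "real^('m \<times> 'm) \<Rightarrow> real^'m^'m" where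
  "unvec v = (\<chi> i j. v $ (j, i))"

definition block2 ::
  "real^'k^'k \<Rightarrow> real^'k^'k \<Rightarrow> real^'k^'k \<Rightarrow> real^'k^'k \<Rightarrow> real^('k + 'k)^('k + 'k)" where
  "block2 X11 X12 X21 X22 = (\<chi> r c.
     (case (r, c) of
        (Inl i, Inl j) \<Rightarrow> X11 $ i $ j
      | (Inl i, Inr j) \<Rightarrow> X12 $ i $ j
      | (Inr i, Inl j) \<Rightarrow> X21 $ i $ j
      | (Inr i, Inr j) \<Rightarrow> X22 $ i $ j))"

definition stack2 :: "real^'k \<Rightarrow> real^'k \<Rightarrow> real^('k + 'k)" where
  "stack2 u v = (\<chi> r. (case r of Inl i \<Rightarrow> u $ i | Inr i \<Rightarrow> v $ i))"

definition upper :: "real^('k + 'k) \<Rightarrow> real^'k" where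
  "upper w = (\<chi> i. w $ Inl i)"

definition lower :: "real^('k + 'k) \<Rightarrow> real^'k" where
  "lower w = (\<chi> i. w $ Inr i)"

text \<open>
  A real matrix of variable size is a function of its row and column index together with a
  finite index set.
\<close>

definition pos_def_on :: "'i set \<Rightarrow> ('i \<Rightarrow> 'i \<Rightarrow> real) \<Rightarrow> bool" where
  "pos_def_on I P \<longleftrightarrow>
     (\<forall>r\<in>I. \<forall>c\<in>I. P r c = P c r) \<and>
     (\<forall>v. (\<exists>r\<in>I. v r \<noteq> 0) \<longrightarrow> 0 < (\<Sum>r\<in>I. \<Sum>c\<in>I. v r * P r c * v c))"

section \<open>The time-delay system\<close>

definition piecewise_continuous :: "real \<Rightarrow> real \<Rightarrow> (real \<Rightarrow> 'b::topological_space) \<Rightarrow> bool" where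
  "piecewise_continuous a b f \<longleftrightarrow>
     (\<exists>S. finite S \<and> S \<subseteq> {a..b} \<and> continuous_on ({a..b} - S) f \<and>
        (\<forall>s\<in>S. (\<exists>L. (f \<longlongrightarrow> L) (at s within {a..<s})) \<and>
                (\<exists>R. (f \<longlongrightarrow> R) (at s within {s<..b}))))"

text \<open>
  Since the initial function may jump, the derivative of a solution may fail to exist at
  finitely many times; at all other times the differential equation holds.
\<close>

definition is_solution ::
  "real \<Rightarrow> real^'m^'m \<Rightarrow> real^'m^'m \<Rightarrow> (real \<Rightarrow> real^'m) \<Rightarrow> (real \<Rightarrow> real^'m) \<Rightarrow> bool" where
  "is_solution h A Ad \<phi> x \<longleftrightarrow>
     (\<forall>\<tau>\<in>{-h..0}. x \<tau> = \<phi> \<tau>) \<and>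
     continuous_on {0..} x \<and>
     (\<exists>S. finite S \<and>
        (\<forall>t\<in>{0..} - S.
           (x has_vector_derivative (A *v x t + Ad *v x (t - h))) (at t within {0..})))"

definition segment_norm :: "real \<Rightarrow> (real \<Rightarrow> real^'m) \<Rightarrow> real \<Rightarrow> real" where
  "segment_norm h x t = (SUP \<tau>\<in>{-h..0}. norm (x (t + \<tau>)))"

definition exponentially_stable :: "real \<Rightarrow> real^'m^'m \<Rightarrow> real^'m^'m \<Rightarrow> bool" where
  "exponentially_stable h A Ad \<longleftrightarrow>
     (\<exists>\<kappa> \<alpha>. 1 \<le> \<kappa> \<and> 0 < \<alpha> \<and>
        (\<forall>\<phi> x. piecewise_continuous (-h) 0 \<phi> \<longrightarrow> is_solution h A Ad \<phi> x \<longrightarrow>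
           (\<forall>t\<ge>0. segment_norm h x t \<le> \<kappa> * exp (- \<alpha> * t) * segment_norm h x 0)))"

section \<open>The Lyapunov matrix\<close>

definition lyap_M :: "real^'m^'m \<Rightarrow> real^'m^'m \<Rightarrow> real^('m \<times> 'm + 'm \<times> 'm)^('m \<times> 'm + 'm \<times> 'm)" where
  "lyap_M A Ad =
     block2 (kron (transpose A) (mat 1))      (kron (transpose Ad) (mat 1))
            (- kron (mat 1) (transpose Ad))   (- kron (mat 1) (transpose A))"

definition lyap_N ::
  "real \<Rightarrow> real^'m^'m \<Rightarrow> real^'m^'m \<Rightarrow> real^('m \<times> 'm + 'm \<times> 'm)^('m \<times> 'm + 'm \<times> 'm)" where
  "lyap_N h A Ad =
     block2 (kron (transpose A) (mat 1) + kron (mat 1) (transpose A)) (kron (transpose Ad) (mat 1))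
            (mat 1)                                                   0
     + block2 (kron (mat 1) (transpose Ad)) 0
              0                             (- mat 1)
       ** mexp (h *\<^sub>R lyap_M A Ad)"

definition lyap_U :: "real \<Rightarrow> real^'m^'m \<Rightarrow> real^'m^'m \<Rightarrow> real \<Rightarrow> real^'m^'m" where
  "lyap_U h A Ad \<tau> =
     (let w = matrix_inv (lyap_N h A Ad) *v stack2 (- vec_of (mat 1)) 0 in
      unvec (if 0 \<le> \<tau> then upper (mexp (\<tau> *\<^sub>R lyap_M A Ad) *v w)
             else lower (mexp ((h + \<tau>) *\<^sub>R lyap_M A Ad) *v w)))"

section \<open>Legendre polynomials and the matrices of the stability test\<close>

definition legendre :: "real \<Rightarrow> nat \<Rightarrow> real \<Rightarrow> real" where
  "legendre h k \<tau> =
     (-1) ^ k * (\<Sum>j\<le>k. (-1) ^ j * real (k choose j) * real ((k + j) choose j) * ((\<tau> + h) / h) ^ j)"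

text \<open>
  The \<open>k\<close>-th \<open>m \<times> m\<close> block (\<open>k < n\<close>) of \<open>\<ell>\<^sub>n(\<tau>)\<close>; it does not depend on \<open>n\<close>.
  Accordingly \<open>Q_block\<close> and \<open>T_block\<close> are the \<open>m \<times> m\<close> blocks of \<open>\<^bold>Q\<^sub>n\<close> and \<open>\<^bold>T\<^sub>n\<close>,
  and \<open>Iinv_block\<close> those of the inverse of
  \<open>\<^bold>I\<^sub>n = diag (1/h, 3/h, \<dots>, (2n-1)/h) \<otimes> I\<^sub>m\<close>.
\<close>

definition ell_block :: "real \<Rightarrow> nat \<Rightarrow> real \<Rightarrow> real^'m^'m" where
  "ell_block h k \<tau> = legendre h k \<tau> *\<^sub>R mat 1"

definition Q_block :: "real \<Rightarrow> real^'m^'m \<Rightarrow> real^'m^'m \<Rightarrow> nat \<Rightarrow> real^'m^'m" where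
  "Q_block h A Ad k =
     integral {-h..0} (\<lambda>\<tau>. transpose (lyap_U h A Ad (h + \<tau>)) ** Ad ** transpose (ell_block h k \<tau>))"

definition T_block :: "real \<Rightarrow> real^'m^'m \<Rightarrow> real^'m^'m \<Rightarrow> nat \<Rightarrow> nat \<Rightarrow> real^'m^'m" where
  "T_block h A Ad k l =
     integral {-h..0} (\<lambda>\<tau>\<^sub>2. integral {-h..0} (\<lambda>\<tau>\<^sub>1.
       ell_block h k \<tau>\<^sub>1 ** transpose Ad ** lyap_U h A Ad (\<tau>\<^sub>1 - \<tau>\<^sub>2) ** Ad
         ** transpose (ell_block h l \<tau>\<^sub>2)))"

definition Iinv_block :: "real \<Rightarrow> nat \<Rightarrow> nat \<Rightarrow> real^'m^'m" where
  "Iinv_block h k l = (if k = l then (h / (2 * real k + 1)) *\<^sub>R mat 1 else 0)"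

text \<open>
  \<open>\<^bold>P\<^sub>n\<close> is the matrix \<open>P_mat h A Ad\<close> on the index set \<open>P_index n\<close> of size \<open>m + n m\<close>: the index
  \<open>Inl i\<close> is row \<open>i\<close> of the leading \<open>m \<times> m\<close> block, and \<open>Inr (k, i)\<close> is row \<open>i\<close> of the block
  belonging to \<open>l\<^sub>k\<close>.
\<close>

definition P_index :: "nat \<Rightarrow> ('m + nat \<times> 'm) set" where
  "P_index n = range Inl \<union> Inr ` ({..<n} \<times> UNIV)"

definition P_mat ::
  "real \<Rightarrow> real^'m^'m \<Rightarrow> real^'m^'m \<Rightarrow> 'm + nat \<times> 'm \<Rightarrow> 'm + nat \<times> 'm \<Rightarrow> real" where
  "P_mat h A Ad r c =
     (case (r, c) of
        (Inl i, Inl j) \<Rightarrow> lyap_U h A Ad 0 $ i $ j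
      | (Inl i, Inr (l, j)) \<Rightarrow> Q_block h A Ad l $ i $ j
      | (Inr (k, i), Inl j) \<Rightarrow> transpose (Q_block h A Ad k) $ i $ j
      | (Inr (k, i), Inr (l, j)) \<Rightarrow> (T_block h A Ad k l + Iinv_block h k l) $ i $ j)"

end

theory Submission
  imports Defs
begin

text \<open>
  Exponential stability forces every \<open>\<^bold>P\<^sub>n\<close> to be positive definite, because the quadratic form of
  \<open>\<^bold>P\<^sub>n\<close> is the energy of a trajectory. Given coefficient vectors \<open>v\<^sub>0\<close> and \<open>c\<^sub>0, \<dots>, c\<^bsub>n-1\<^esub>\<close>, let \<open>x\<close>
  be the solution that starts from the value \<open>v\<^sub>0\<close> at time \<open>0\<close> and from the history
  \<open>g = \<Sum>\<^sub>k l\<^sub>k c\<^sub>k\<close> on \<open>[-h, 0)\<close>. Then the quadratic form equals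
  \<open>V + \<Sum>\<^sub>k h/(2k+1) |c\<^sub>k|\<^sup>2\<close>, where \<open>V\<close> is the Lyapunov-Krasovskii functional of the initial
  state (\<open>P_mat_quadratic_form_eq_energy\<close>). If the system is stable, then
  \<open>V = \<integral>\<^sub>0\<^sup>\<infinity> |x(t)|\<^sup>2 dt\<close>, of which the inequality \<open>V \<ge> \<integral>\<^sub>0\<^sup>1 |x(t)|\<^sup>2 dt\<close> is enough
  (\<open>energy_lower_bound\<close>). So the form is positive: a nonzero \<open>c\<^sub>k\<close> makes the sum positive,
  and a nonzero \<open>v\<^sub>0\<close> makes the integral positive, since \<open>x\<close> is continuous on \<open>[0, \<infinity>)\<close>.

  The identity for \<open>V\<close> is obtained without differentiating the double integral in the functional.
  Write \<open>Y(\<tau>) = U(\<tau>)\<close> and \<open>Z(\<tau>) = U(\<tau> - h)\<close> for the two branches of the Lyapunov matrix.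
  Both are smooth on the whole line, and they satisfy
  \<open>Y' = Y A + Z A\<^sub>d\<close>, \<open>Z' = - A\<^sub>d\<^sup>T Y - A\<^sup>T Z\<close> with boundary conditions that restate the
  equation defining \<open>U\<close>; nonsingularity of \<open>N\<close> makes this boundary value problem uniquely solvable
  and so yields the symmetry \<open>Z(\<tau>) = Y(h - \<tau>)\<^sup>T\<close> (\<open>lyap_Z_eq_transpose_Y\<close>). The costate
  \<open>\<eta>(t) = U(0) x(t) + \<integral>\<^bsub>t-h\<^esub>\<^sup>t Z(t - s) A\<^sub>d x(s) ds\<close>
  solves the advanced equation \<open>\<eta>'(t) = - x(t) - A\<^sup>T \<eta>(t) - A\<^sub>d\<^sup>T \<eta>(t + h)\<close>
  (\<open>costate_has_vector_derivative\<close>), which is adjoint to the delay equation, so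
  that \<open>(x \<bullet> \<eta>)' = - |x|\<^sup>2 + A\<^sub>d x(t - h) \<bullet> \<eta>(t) - A\<^sub>d x(t) \<bullet> \<eta>(t + h)\<close>.
  The last two terms are translates of each other, and integration gives the energy balance
  for \<open>V(t) = x(t) \<bullet> \<eta>(t) + \<integral>\<^bsub>t-h\<^esub>\<^sup>t A\<^sub>d x(u) \<bullet> \<eta>(u + h) du\<close> (\<open>energy_balance\<close>).
  Along a decaying trajectory \<open>V(t)\<close> tends to \<open>0\<close>. At \<open>t = 0\<close> the costate on \<open>[0, h]\<close> can be
  expressed through the initial data alone, which gives \<open>V(0) = V\<close> (\<open>initial_energy_eq\<close>).

  The second assertion holds because \<open>\<^bold>P\<^sub>n\<close> is a principal submatrix of \<open>\<^bold>P\<^bsub>n+1\<^esub>\<close>.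
\<close>

section \<open>The matrix exponential\<close>

lemma bounded_bilinear_matrix_vector_mult:
  "bounded_bilinear ((*v) :: real^'n^'k \<Rightarrow> real^'n \<Rightarrow> real^'k)"
  unfolding bilinear_conv_bounded_bilinear[symmetric] bilinear_def
  by (auto intro!: linearI simp: matrix_vector_right_distrib matrix_vector_mult_add_rdistrib
      scaleR_matrix_vector_assoc matrix_vector_mult_scaleR)

lemma bounded_bilinear_matrix_matrix_mult:
  "bounded_bilinear ((**) :: real^'n^'k \<Rightarrow> real^'l^'n \<Rightarrow> real^'l^'k)"
  unfolding bilinear_conv_bounded_bilinear[symmetric] bilinear_def
  by (auto intro!: linearI simp: matrix_matrix_mult_def vec_eq_iff
      algebra_simps sum.distrib sum_distrib_left)

lemma mpow_scaleR: "mpow (t *\<^sub>R X) i = t ^ i *\<^sub>R mpow X i"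
  by (induction i) (simp_all add: scalar_matrix_assoc[symmetric] matrix_scalar_ac)

lemma mpow_commute: "X ** mpow X i = mpow X i ** X"
  by (induction i) (simp, metis matrix_mul_assoc mpow.simps(2))

text \<open>
  The sum of the absolute values of all entries serves as a submultiplicative bound; it reduces
  the convergence of the exponential series to scalar power series, one for each entry.
\<close>

lemma mpow_entry_bound:
  fixes X :: "real^'k^'k"
  defines "C \<equiv> \<Sum>r\<in>UNIV. \<Sum>c\<in>UNIV. \<bar>X $ r $ c\<bar>"
  shows "\<bar>mpow X i $ r $ c\<bar> \<le> C ^ i"
proof (induction i arbitrary: r c)
  case 0
  show ?case by (simp add: mat_def)
next
  case (Suc i)
  have C: "0 \<le> C" by (simp add: C_def sum_nonneg)
  have "\<bar>mpow X (Suc i) $ r $ c\<bar> \<le> (\<Sum>k\<in>UNIV. \<bar>X $ r $ k\<bar> * \<bar>mpow X i $ k $ c\<bar>)"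
    by (simp add: matrix_matrix_mult_def abs_mult[symmetric] sum_abs)
  also have "\<dots> \<le> (\<Sum>k\<in>UNIV. \<bar>X $ r $ k\<bar> * C ^ i)"
    by (intro sum_mono mult_left_mono Suc.IH) auto
  also have "\<dots> = (\<Sum>k\<in>UNIV. \<bar>X $ r $ k\<bar>) * C ^ i"
    by (simp add: sum_distrib_right)
  also have "\<dots> \<le> C * C ^ i"
    unfolding C_def
    by (intro mult_right_mono member_le_sum zero_le_power sum_nonneg) (auto intro!: sum_nonneg)
  finally show ?case by simp
qed

lemma summable_mexp_entry:
  fixes X :: "real^'k^'k"
  shows "summable (\<lambda>i. (mpow X i $ r $ c / fact i) * t ^ i)"
proof -
  define C where "C = (\<Sum>r\<in>UNIV. \<Sum>c\<in>UNIV. \<bar>X $ r $ c\<bar>)"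
  have "norm ((mpow X i $ r $ c / fact i) * t ^ i) \<le> inverse (fact i) * (C * \<bar>t\<bar>) ^ i" for i
  proof -
    have "\<bar>mpow X i $ r $ c\<bar> * \<bar>t\<bar> ^ i \<le> C ^ i * \<bar>t\<bar> ^ i"
      using mpow_entry_bound[of X i r c] unfolding C_def by (intro mult_right_mono) auto
    then show ?thesis
      by (simp add: abs_mult power_abs power_mult_distrib field_simps)
  qed
  then show ?thesis
    by (intro summable_comparison_test[OF _ summable_exp[of "C * \<bar>t\<bar>"]]) blast
qed

lemma mexp_scaleR_entry:
  fixes X :: "real^'k^'k"
  shows "mexp (t *\<^sub>R X) $ r $ c = (\<Sum>i. (mpow X i $ r $ c / fact i) * t ^ i)"
proof -
  let ?S = "\<chi> r c. \<Sum>i. (mpow X i $ r $ c / fact i) * t ^ i"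
  have "(\<lambda>i. (1 / fact i) *\<^sub>R mpow (t *\<^sub>R X) i) sums ?S"
    unfolding sums_def
  proof (intro vec_tendstoI)
    fix r c
    have "(\<lambda>n. \<Sum>i<n. (mpow X i $ r $ c / fact i) * t ^ i) \<longlonglongrightarrow> ?S $ r $ c"
      using summable_LIMSEQ[OF summable_mexp_entry[of X r c t]] by simp
    then show "(\<lambda>n. (\<Sum>i<n. (1 / fact i) *\<^sub>R mpow (t *\<^sub>R X) i) $ r $ c) \<longlonglongrightarrow> ?S $ r $ c"
      by (simp add: mpow_scaleR mult.commute)
  qed
  then have "mexp (t *\<^sub>R X) = ?S"
    unfolding mexp_def by (rule sums_unique[symmetric])
  then show ?thesis by simp
qed

lemma has_vector_derivative_matrixI:
  fixes F :: "real \<Rightarrow> real^'n^'k"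
  assumes "\<And>r c. ((\<lambda>t. F t $ r $ c) has_real_derivative (D $ r $ c)) (at t within S)"
  shows "(F has_vector_derivative D) (at t within S)"
  unfolding has_vector_derivative_def
proof (rule has_derivative_componentwise_within[THEN iffD2], rule ballI)
  fix b :: "real^'n^'k"
  assume "b \<in> Basis"
  then obtain r c where b: "b = axis r (axis c 1)"
    by (auto simp: Basis_vec_def)
  show "((\<lambda>x. F x \<bullet> b) has_derivative (\<lambda>x. x *\<^sub>R D \<bullet> b)) (at t within S)"
    using assms[of r c] unfolding has_field_derivative_def b
    by (simp add: inner_axis mult_commute_abs)
qed

lemma mexp_has_vector_derivative:
  fixes X :: "real^'k^'k"
  shows "((\<lambda>t. mexp (t *\<^sub>R X)) has_vector_derivative X ** mexp (t *\<^sub>R X)) (at t within S)"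
proof (rule has_vector_derivative_matrixI)
  fix r c
  let ?a = "\<lambda>r i. mpow X i $ r $ c / fact i"
  have "((\<lambda>t. \<Sum>i. ?a r i * t ^ i) has_real_derivative (\<Sum>i. diffs (?a r) i * t ^ i)) (at t)"
    by (rule termdiffs_strong_converges_everywhere) (rule summable_mexp_entry)
  moreover have "(\<Sum>i. diffs (?a r) i * t ^ i) = (X ** mexp (t *\<^sub>R X)) $ r $ c"
  proof -
    have "diffs (?a r) i * t ^ i = (\<Sum>k\<in>UNIV. X $ r $ k * (?a k i * t ^ i))" for i
    proof -
      have "diffs (?a r) i = (X ** mpow X i) $ r $ c / fact i"
        by (simp add: diffs_def field_simps del: of_nat_Suc)
      then show ?thesis
        by (simp add: matrix_matrix_mult_def sum_divide_distrib sum_distrib_right mult.assoc)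
    qed
    then have "(\<Sum>i. diffs (?a r) i * t ^ i) = (\<Sum>i. \<Sum>k\<in>UNIV. X $ r $ k * (?a k i * t ^ i))"
      by simp
    also have "\<dots> = (\<Sum>k\<in>UNIV. \<Sum>i. X $ r $ k * (?a k i * t ^ i))"
      by (intro suminf_sum summable_mult summable_mexp_entry)
    also have "\<dots> = (\<Sum>k\<in>UNIV. X $ r $ k * (\<Sum>i. ?a k i * t ^ i))"
      by (intro sum.cong refl suminf_mult summable_mexp_entry)
    also have "\<dots> = (X ** mexp (t *\<^sub>R X)) $ r $ c"
      by (simp add: matrix_matrix_mult_def mexp_scaleR_entry)
    finally show ?thesis .
  qed
  ultimately show "((\<lambda>t. mexp (t *\<^sub>R X) $ r $ c) has_real_derivative (X ** mexp (t *\<^sub>R X)) $ r $ c)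
      (at t within S)"
    by (simp add: mexp_scaleR_entry has_field_derivative_at_within)
qed

lemma mexp_0: "mexp 0 = (mat 1 :: real^'k^'k)"
proof -
  have "mexp (0 *\<^sub>R (0::real^'k^'k)) $ r $ c = (mat 1 :: real^'k^'k) $ r $ c" for r c
    unfolding mexp_scaleR_entry powser_zero by simp
  then show ?thesis by (simp add: vec_eq_iff)
qed

lemma mexp_commute:
  fixes X :: "real^'k^'k"
  shows "X ** mexp (t *\<^sub>R X) = mexp (t *\<^sub>R X) ** X"
proof -
  have "(X ** mexp (t *\<^sub>R X)) $ r $ c = (mexp (t *\<^sub>R X) ** X) $ r $ c" for r c
  proof -
    let ?a = "\<lambda>r c i. (mpow X i $ r $ c / fact i) * t ^ i"
    have left: "(X ** mpow X i) $ r $ c / fact i * t ^ i = (\<Sum>k\<in>UNIV. X $ r $ k * ?a k c i)" for i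
      by (simp add: matrix_matrix_mult_def sum_divide_distrib sum_distrib_right mult.assoc)
    have right: "(mpow X i ** X) $ r $ c / fact i * t ^ i = (\<Sum>k\<in>UNIV. ?a r k i * X $ k $ c)" for i
      by (simp add: matrix_matrix_mult_def sum_divide_distrib sum_distrib_left mult_ac)
    have "(X ** mexp (t *\<^sub>R X)) $ r $ c = (\<Sum>k\<in>UNIV. X $ r $ k * (\<Sum>i. ?a k c i))"
      by (simp add: matrix_matrix_mult_def mexp_scaleR_entry)
    also have "\<dots> = (\<Sum>k\<in>UNIV. \<Sum>i. X $ r $ k * ?a k c i)"
      by (intro sum.cong refl suminf_mult[symmetric] summable_mexp_entry)
    also have "\<dots> = (\<Sum>i. \<Sum>k\<in>UNIV. X $ r $ k * ?a k c i)"
      by (intro suminf_sum[symmetric] summable_mult summable_mexp_entry)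
    also have "\<dots> = (\<Sum>i. \<Sum>k\<in>UNIV. ?a r k i * X $ k $ c)"
      unfolding left[symmetric] right[symmetric] mpow_commute ..
    also have "\<dots> = (\<Sum>k\<in>UNIV. \<Sum>i. ?a r k i * X $ k $ c)"
      by (intro suminf_sum summable_mult2 summable_mexp_entry)
    also have "\<dots> = (\<Sum>k\<in>UNIV. (\<Sum>i. ?a r k i) * X $ k $ c)"
      by (intro sum.cong refl suminf_mult2[symmetric] summable_mexp_entry)
    also have "\<dots> = (mexp (t *\<^sub>R X) ** X) $ r $ c"
      by (simp add: matrix_matrix_mult_def mexp_scaleR_entry)
    finally show ?thesis .
  qed
  then show ?thesis by (simp add: vec_eq_iff)
qed

lemma mexp_neg_has_vector_derivative:
  fixes X :: "real^'k^'k"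
  shows "((\<lambda>t. mexp ((- t) *\<^sub>R X)) has_vector_derivative - (mexp ((- t) *\<^sub>R X) ** X)) (at t within S)"
proof -
  have "((\<lambda>t. mexp (t *\<^sub>R (- X))) has_vector_derivative (- X) ** mexp (t *\<^sub>R (- X))) (at t within S)"
    by (rule mexp_has_vector_derivative)
  moreover have "(- X) ** mexp (t *\<^sub>R (- X)) = - (mexp ((- t) *\<^sub>R X) ** X)"
    using mexp_commute[of X "- t"]
    by (simp add: bounded_bilinear.minus_left[OF bounded_bilinear_matrix_matrix_mult])
  ultimately show ?thesis by simp
qed

text \<open>
  Uniqueness for \<open>u' = X u\<close>: the function \<open>e\<^bsup>-tX\<^esup> u(t)\<close> has derivative zero. Applied to
  \<open>u(t) = e\<^bsup>tX\<^esup> v\<close> this also shows that \<open>e\<^bsup>-tX\<^esup>\<close> is the inverse of \<open>e\<^bsup>tX\<^esup>\<close>, which turns it into the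
  solution formula below.
\<close>

lemma mexp_ode_aux:
  fixes X :: "real^'k^'k" and u :: "real \<Rightarrow> real^'k"
  assumes "is_interval I" "0 \<in> I" "t \<in> I"
    and u: "\<And>s. s \<in> I \<Longrightarrow> (u has_vector_derivative X *v u s) (at s within I)"
  shows "mexp ((- t) *\<^sub>R X) *v u t = u 0"
proof -
  have "((\<lambda>s. mexp ((- s) *\<^sub>R X) *v u s) has_vector_derivative 0) (at s within I)" if "s \<in> I" for s
  proof -
    have "((\<lambda>s. mexp ((- s) *\<^sub>R X) *v u s) has_vector_derivative
        mexp ((- s) *\<^sub>R X) *v (X *v u s) + (- (mexp ((- s) *\<^sub>R X) ** X)) *v u s) (at s within I)"
      by (intro bounded_bilinear.has_vector_derivative[OF bounded_bilinear_matrix_vector_mult]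
          mexp_neg_has_vector_derivative u that)
    then show ?thesis
      by (simp add: matrix_vector_mul_assoc
          bounded_bilinear.minus_left[OF bounded_bilinear_matrix_vector_mult])
  qed
  then obtain c where "\<And>s. s \<in> I \<Longrightarrow> mexp ((- s) *\<^sub>R X) *v u s = c"
    using has_vector_derivative_zero_constant[OF is_interval_convex[OF assms(1)],
        of "\<lambda>s. mexp ((- s) *\<^sub>R X) *v u s"] by blast
  from this[of t] this[of 0] show ?thesis using assms by (simp add: mexp_0)
qed

lemma mexp_neg_mult: "mexp ((- t) *\<^sub>R X) ** mexp (t *\<^sub>R X) = mat 1"
  for X :: "real^'k^'k"
proof -
  have "mexp ((- t) *\<^sub>R X) *v (mexp (t *\<^sub>R X) *v v) = v" for v
  proof -
    have "mexp ((- t) *\<^sub>R X) *v (mexp (t *\<^sub>R X) *v v) = mexp (0 *\<^sub>R X) *v v"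
    proof (rule mexp_ode_aux[where I = UNIV])
      fix s
      show "((\<lambda>t. mexp (t *\<^sub>R X) *v v) has_vector_derivative X *v (mexp (s *\<^sub>R X) *v v)) (at s within UNIV)"
        using bounded_bilinear.has_vector_derivative[OF bounded_bilinear_matrix_vector_mult
            mexp_has_vector_derivative has_vector_derivative_const[of v], of X s UNIV]
        by (simp add: matrix_vector_mul_assoc)
    qed auto
    then show ?thesis by (simp add: mexp_0)
  qed
  then show ?thesis
    by (metis matrix_eq matrix_vector_mul_assoc matrix_vector_mul_lid)
qed

lemma mexp_mult_neg: "mexp (t *\<^sub>R X) ** mexp ((- t) *\<^sub>R X) = mat 1"
  for X :: "real^'k^'k"
  using mexp_neg_mult[of "- t" X] by simp

lemma mexp_vec_has_vector_derivative:
  "((\<lambda>t. mexp (t *\<^sub>R X) *v v) has_vector_derivative X *v (mexp (t *\<^sub>R X) *v v)) (at t within S)"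
  using bounded_bilinear.has_vector_derivative[OF bounded_bilinear_matrix_vector_mult
      mexp_has_vector_derivative has_vector_derivative_const[of v], of X t S]
  by (simp add: matrix_vector_mul_assoc)

lemma mexp_ode_unique:
  fixes X :: "real^'k^'k" and u :: "real \<Rightarrow> real^'k"
  assumes "\<And>s. (u has_vector_derivative X *v u s) (at s)"
  shows "u t = mexp (t *\<^sub>R X) *v u 0"
proof -
  have "mexp ((- t) *\<^sub>R X) *v u t = u 0"
    by (rule mexp_ode_aux[where I = UNIV]) (use assms in auto)
  then have "mexp (t *\<^sub>R X) *v (mexp ((- t) *\<^sub>R X) *v u t) = mexp (t *\<^sub>R X) *v u 0"
    by simp
  then show ?thesis
    by (metis matrix_vector_mul_assoc matrix_vector_mul_lid mexp_mult_neg)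
qed

text \<open>
  Both sides, as functions of \<open>t\<close>, solve the same linear equation with the same initial value.
\<close>

lemma mexp_diff_vec:
  fixes X :: "real^'k^'k"
  shows "mexp ((t - s) *\<^sub>R X) *v v = mexp (t *\<^sub>R X) *v (mexp ((- s) *\<^sub>R X) *v v)"
proof -
  have "((\<lambda>t. mexp ((t - s) *\<^sub>R X) *v v) has_vector_derivative X *v (mexp ((r - s) *\<^sub>R X) *v v)) (at r)" for r
  proof -
    have "((\<lambda>t. t - s) has_vector_derivative 1) (at r)"
      by (auto intro!: derivative_eq_intros)
    from vector_diff_chain_at[OF this mexp_vec_has_vector_derivative] show ?thesis
      by (simp add: o_def)
  qed
  from mexp_ode_unique[of "\<lambda>t. mexp ((t - s) *\<^sub>R X) *v v", OF this, of t]
  show ?thesis by simp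
qed

lemma continuous_on_mexp: "continuous_on S (\<lambda>t. mexp (t *\<^sub>R X))"
  for X :: "real^'k^'k"
  by (rule continuous_on_vector_derivative) (rule mexp_has_vector_derivative)

section \<open>The Lyapunov matrix as solution of a boundary value problem\<close>

definition lyap_w :: "real \<Rightarrow> real^'m^'m \<Rightarrow> real^'m^'m \<Rightarrow> real^('m \<times> 'm + 'm \<times> 'm)" where
  "lyap_w h A Ad = matrix_inv (lyap_N h A Ad) *v stack2 (- vec_of (mat 1)) 0"

text \<open>
  The two branches of the Lyapunov matrix, \<open>Y(\<tau>) = U(\<tau>)\<close> for \<open>\<tau> \<ge> 0\<close> and
  \<open>Z(\<tau>) = U(\<tau> - h)\<close> for \<open>\<tau> < h\<close>. Each is extended to the whole line, so that derivatives
  need no care at the points where the branches meet.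
\<close>

definition lyap_Y :: "real \<Rightarrow> real^'m^'m \<Rightarrow> real^'m^'m \<Rightarrow> real \<Rightarrow> real^'m^'m" where
  "lyap_Y h A Ad \<tau> = unvec (upper (mexp (\<tau> *\<^sub>R lyap_M A Ad) *v lyap_w h A Ad))"

definition lyap_Z :: "real \<Rightarrow> real^'m^'m \<Rightarrow> real^'m^'m \<Rightarrow> real \<Rightarrow> real^'m^'m" where
  "lyap_Z h A Ad \<tau> = unvec (lower (mexp (\<tau> *\<^sub>R lyap_M A Ad) *v lyap_w h A Ad))"

lemma lyap_U_eq:
  "lyap_U h A Ad \<tau> = (if 0 \<le> \<tau> then lyap_Y h A Ad \<tau> else lyap_Z h A Ad (h + \<tau>))"
  by (simp add: lyap_U_def lyap_Y_def lyap_Z_def lyap_w_def Let_def)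

lemma bounded_linear_unvec_upper: "bounded_linear (\<lambda>v. unvec (upper v))"
  unfolding linear_conv_bounded_linear[symmetric]
  by (rule linearI) (simp_all add: unvec_def upper_def vec_eq_iff)

lemma bounded_linear_unvec_lower: "bounded_linear (\<lambda>v. unvec (lower v))"
  unfolding linear_conv_bounded_linear[symmetric]
  by (rule linearI) (simp_all add: unvec_def lower_def vec_eq_iff)

lemma sum_UNIV_Plus:
  fixes f :: "'a::finite + 'b::finite \<Rightarrow> 'c::comm_monoid_add"
  shows "sum f UNIV = (\<Sum>i\<in>UNIV. f (Inl i)) + (\<Sum>i\<in>UNIV. f (Inr i))"
  by (simp add: UNIV_Plus_UNIV[symmetric] sum.Plus del: UNIV_Plus_UNIV)

lemma sum_UNIV_prod:
  fixes f :: "'a::finite \<times> 'b::finite \<Rightarrow> 'c::comm_monoid_add"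
  shows "sum f UNIV = (\<Sum>i\<in>UNIV. \<Sum>j\<in>UNIV. f (i, j))"
  by (simp add: UNIV_Times_UNIV[symmetric] sum.cartesian_product split_def del: UNIV_Times_UNIV)

lemma upper_block2: "upper (block2 X11 X12 X21 X22 *v w) = X11 *v upper w + X12 *v lower w"
  and lower_block2: "lower (block2 X11 X12 X21 X22 *v w) = X21 *v upper w + X22 *v lower w"
  by (simp_all add: upper_def lower_def block2_def matrix_vector_mult_def vec_eq_iff sum_UNIV_Plus)

lemma unvec_kron_left: "unvec (kron (transpose B) (mat 1) *v v) = unvec v ** B"
  by (simp add: unvec_def kron_def matrix_vector_mult_def matrix_matrix_mult_def vec_eq_iff
      sum_UNIV_prod transpose_def mat_def if_distrib if_distribR sum.delta mult.commute cong: if_cong)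

lemma unvec_kron_right: "unvec (kron (mat 1) B *v v) = B ** unvec v"
proof -
  have "(\<Sum>l\<in>UNIV. \<Sum>k\<in>UNIV. mat 1 $ j $ l * B $ i $ k * v $ (l, k)) = (\<Sum>k\<in>UNIV. B $ i $ k * v $ (j, k))"
    for i j
    by (subst sum.swap) (simp add: mat_def if_distrib if_distribR sum.delta cong: if_cong)
  then show ?thesis
    by (simp add: unvec_def kron_def matrix_vector_mult_def matrix_matrix_mult_def vec_eq_iff
        sum_UNIV_prod)
qed

lemma unvec_add: "unvec (u + v) = unvec u + unvec v"
  and unvec_minus: "unvec (- u) = - unvec u"
  and unvec_diff: "unvec (u - v) = unvec u - unvec v"
  and unvec_zero: "unvec 0 = 0"
  and unvec_vec_of: "unvec (vec_of X) = X"
  and vec_of_unvec: "vec_of (unvec u) = u"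
  by (simp_all add: unvec_def vec_of_def vec_eq_iff)

text \<open>
  The matrix \<open>M\<close> is the vectorised form of the linear system for the pair \<open>(Y, Z)\<close>.
\<close>

lemma unvec_upper_lyap_M:
  "unvec (upper (lyap_M A Ad *v v)) = unvec (upper v) ** A + unvec (lower v) ** Ad"
  by (simp add: lyap_M_def upper_block2 unvec_add unvec_kron_left)

lemma unvec_lower_lyap_M:
  "unvec (lower (lyap_M A Ad *v v))
     = - (transpose Ad ** unvec (upper v)) - transpose A ** unvec (lower v)"
  by (simp add: lyap_M_def lower_block2 unvec_diff unvec_kron_right unvec_minus
      bounded_bilinear.minus_left[OF bounded_bilinear_matrix_vector_mult])

lemma stack2_eq_iff: "w = stack2 a b \<longleftrightarrow> upper w = a \<and> lower w = b"
  by (auto simp: stack2_def upper_def lower_def vec_eq_iff split: sum.split)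

lemma upper_stack2 [simp]: "upper (stack2 a b) = a" and lower_stack2 [simp]: "lower (stack2 a b) = b"
  using stack2_eq_iff by blast+

lemma unvec_inject: "unvec u = unvec v \<longleftrightarrow> u = v"
  by (metis vec_of_unvec)

text \<open>
  The rows of the equation for the initial vector are the two boundary conditions: the algebraic
  Lyapunov equation at \<open>\<tau> = 0\<close>, and the continuity of \<open>U\<close> at \<open>\<tau> = 0\<close>.
\<close>

lemma lyap_N_eq_iff:
  fixes w :: "real^('m::finite \<times> 'm + 'm \<times> 'm)"
  defines "Y \<equiv> \<lambda>\<tau> A Ad. unvec (upper (mexp (\<tau> *\<^sub>R lyap_M A Ad) *v w))"
    and "Z \<equiv> \<lambda>\<tau> A Ad. unvec (lower (mexp (\<tau> *\<^sub>R lyap_M A Ad) *v w))"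
  shows "lyap_N h A Ad *v w = stack2 (- vec_of (mat 1)) 0 \<longleftrightarrow>
    Y 0 A Ad ** A + transpose A ** Y 0 A Ad + Z 0 A Ad ** Ad + transpose Ad ** Y h A Ad = - mat 1 \<and>
    Y 0 A Ad = Z h A Ad"
proof -
  let ?e = "mexp (h *\<^sub>R lyap_M A Ad) *v w"
  have *: "lyap_N h A Ad *v w =
     block2 (kron (transpose A) (mat 1) + kron (mat 1) (transpose A)) (kron (transpose Ad) (mat 1))
            (mat 1) 0 *v w
     + block2 (kron (mat 1) (transpose Ad)) 0 0 (- mat 1) *v ?e"
    by (simp add: lyap_N_def matrix_vector_mult_add_rdistrib matrix_vector_mul_assoc)
  have add: "upper (u + v) = upper u + upper v" "lower (u + v) = lower u + lower v"
    for u v :: "real^('m::finite \<times> 'm + 'm \<times> 'm)"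
    by (simp_all add: upper_def lower_def vec_eq_iff)
  have upper: "unvec (upper (lyap_N h A Ad *v w)) =
     Y 0 A Ad ** A + transpose A ** Y 0 A Ad + Z 0 A Ad ** Ad + transpose Ad ** Y h A Ad"
    by (simp add: * add upper_block2 unvec_add unvec_kron_left unvec_kron_right Y_def Z_def mexp_0
        matrix_vector_mult_add_rdistrib)
  have lower: "unvec (lower (lyap_N h A Ad *v w)) = Y 0 A Ad - Z h A Ad"
    by (simp add: * add lower_block2 unvec_diff Y_def Z_def mexp_0
        bounded_bilinear.minus_left[OF bounded_bilinear_matrix_vector_mult])
  have "lyap_N h A Ad *v w = stack2 (- vec_of (mat 1)) 0 \<longleftrightarrow>
      unvec (upper (lyap_N h A Ad *v w)) = - mat 1 \<and> unvec (lower (lyap_N h A Ad *v w)) = 0"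
    unfolding stack2_eq_iff
    by (metis unvec_inject unvec_minus unvec_vec_of unvec_zero upper_stack2 lower_stack2)
  then show ?thesis
    by (simp add: upper lower)
qed

lemma has_vector_derivative_lyap:
  fixes w :: "real^('m::finite \<times> 'm + 'm \<times> 'm)"
  defines "Y \<equiv> \<lambda>\<tau> A Ad. unvec (upper (mexp (\<tau> *\<^sub>R lyap_M A Ad) *v w))"
    and "Z \<equiv> \<lambda>\<tau> A Ad. unvec (lower (mexp (\<tau> *\<^sub>R lyap_M A Ad) *v w))"
  shows "((\<lambda>\<tau>. Y \<tau> A Ad) has_vector_derivative Y \<tau> A Ad ** A + Z \<tau> A Ad ** Ad) (at \<tau>)"
    and "((\<lambda>\<tau>. Z \<tau> A Ad) has_vector_derivative - (transpose Ad ** Y \<tau> A Ad) - transpose A ** Z \<tau> A Ad) (at \<tau>)"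
  unfolding Y_def Z_def unvec_upper_lyap_M[symmetric] unvec_lower_lyap_M[symmetric]
  by (intro bounded_linear.has_vector_derivative[OF bounded_linear_unvec_upper]
      bounded_linear.has_vector_derivative[OF bounded_linear_unvec_lower] mexp_vec_has_vector_derivative)+

lemma bounded_linear_transpose: "bounded_linear (transpose :: real^'n^'k \<Rightarrow> real^'k^'n)"
  unfolding linear_conv_bounded_linear[symmetric]
  by (rule linearI) (simp_all add: transpose_def vec_eq_iff)

lemma transpose_add: "transpose (X + Y) = transpose X + transpose Y"
  and transpose_minus: "transpose (- X) = - transpose X"
  and transpose_diff: "transpose (X - Y) = transpose X - transpose Y"
  for X Y :: "real^'n^'k"
  by (simp_all add: transpose_def vec_eq_iff)

lemma matrix_inv_inverse:
  fixes X :: "real^'k^'k"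
  assumes "invertible X"
  shows "X ** matrix_inv X = mat 1" and "matrix_inv X ** X = mat 1"
  using someI_ex[OF assms[unfolded invertible_def]] unfolding matrix_inv_def by auto

text \<open>
  The third claim is the symmetry \<open>U(-\<tau>) = U(\<tau>)\<^sup>T\<close>. The reflected pair
  \<open>(Z(h - \<tau>)\<^sup>T, Y(h - \<tau>)\<^sup>T)\<close> solves the same linear system with the same boundary conditions as
  \<open>(Y, Z)\<close>. Its initial vector is therefore sent to the same right-hand side by \<open>N\<close>, and
  invertibility of \<open>N\<close> makes the two pairs equal.
\<close>

lemma
  fixes A Ad :: "real^'m^'m"
  assumes "invertible (lyap_N h A Ad)"
  shows lyap_YZ_boundary: "lyap_Y h A Ad 0 = lyap_Z h A Ad h"
    and lyap_YZ_lyapunov: "lyap_Y h A Ad 0 ** A + transpose A ** lyap_Y h A Ad 0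
        + lyap_Z h A Ad 0 ** Ad + transpose Ad ** lyap_Y h A Ad h = - mat 1"
    and lyap_Z_eq_transpose_Y: "lyap_Z h A Ad \<tau> = transpose (lyap_Y h A Ad (h - \<tau>))"
proof -
  let ?M = "lyap_M A Ad" and ?N = "lyap_N h A Ad" and ?rhs = "stack2 (- vec_of (mat 1)) 0 :: real^('m \<times> 'm + 'm \<times> 'm)"
  define w where "w = lyap_w h A Ad"
  have inv: "v = w \<longleftrightarrow> ?N *v v = ?rhs" for v
    using assms unfolding w_def lyap_w_def
    by (metis matrix_inv_inverse matrix_vector_mul_assoc matrix_vector_mul_lid)
  define Y where "Y = lyap_Y h A Ad"
  define Z where "Z = lyap_Z h A Ad"
  have YZ: "Y = (\<lambda>\<tau>. unvec (upper (mexp (\<tau> *\<^sub>R ?M) *v w)))" "Z = (\<lambda>\<tau>. unvec (lower (mexp (\<tau> *\<^sub>R ?M) *v w)))"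
    by (simp_all add: fun_eq_iff Y_def Z_def lyap_Y_def lyap_Z_def w_def)
  have N: "?N *v w = ?rhs" using inv by blast
  show B: "lyap_Y h A Ad 0 = lyap_Z h A Ad h"
    and L: "lyap_Y h A Ad 0 ** A + transpose A ** lyap_Y h A Ad 0
        + lyap_Z h A Ad 0 ** Ad + transpose Ad ** lyap_Y h A Ad h = - mat 1"
    using N unfolding lyap_N_eq_iff Y_def[symmetric] Z_def[symmetric] YZ by blast+
  have dY: "(Y has_vector_derivative Y \<tau> ** A + Z \<tau> ** Ad) (at \<tau>)"
    and dZ: "(Z has_vector_derivative - (transpose Ad ** Y \<tau>) - transpose A ** Z \<tau>) (at \<tau>)" for \<tau>
    unfolding YZ by (rule has_vector_derivative_lyap)+
  define u where "u \<tau> = stack2 (vec_of (transpose (Z (h - \<tau>)))) (vec_of (transpose (Y (h - \<tau>))))" for \<tau>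
  have du: "(u has_vector_derivative ?M *v u \<tau>) (at \<tau>)" for \<tau>
  proof -
    have refl: "((\<lambda>t. h - t) has_vector_derivative - 1) (at \<tau>)"
      by (auto intro!: derivative_eq_intros)
    let ?R = "\<lambda>x. stack2 (vec_of (transpose (snd x))) (vec_of (transpose (fst x)))
        :: real^('m \<times> 'm + 'm \<times> 'm)"
    have bl: "bounded_linear ?R"
      unfolding linear_conv_bounded_linear[symmetric]
      by (rule linearI) (auto simp: stack2_def vec_of_def transpose_def vec_eq_iff split: sum.split)
    have "((\<lambda>t. (Y t, Z t)) has_vector_derivative
       (Y t ** A + Z t ** Ad, - (transpose Ad ** Y t) - transpose A ** Z t)) (at t)" for t
      by (intro has_vector_derivative_Pair dY dZ)
    from bounded_linear.has_vector_derivative[OF bl vector_diff_chain_at[OF refl this]]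
    have "(u has_vector_derivative ?R (- 1 *\<^sub>R (Y (h - \<tau>) ** A + Z (h - \<tau>) ** Ad,
        - (transpose Ad ** Y (h - \<tau>)) - transpose A ** Z (h - \<tau>)))) (at \<tau>)"
      by (simp only: u_def[abs_def] o_def fst_conv snd_conv)
    moreover have "?M *v u \<tau> = ?R (- 1 *\<^sub>R (Y (h - \<tau>) ** A + Z (h - \<tau>) ** Ad,
        - (transpose Ad ** Y (h - \<tau>)) - transpose A ** Z (h - \<tau>)))"
      unfolding stack2_eq_iff unvec_inject[symmetric] unvec_upper_lyap_M unvec_lower_lyap_M
      by (simp add: u_def unvec_vec_of unvec_minus transpose_add transpose_minus transpose_diff
          matrix_transpose_mul transpose_transpose)
    ultimately show ?thesis by simp
  qed
  have u: "u \<tau> = mexp (\<tau> *\<^sub>R ?M) *v u 0" for \<tau>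
    by (rule mexp_ode_unique) (rule du)
  have "?N *v u 0 = ?rhs"
    unfolding lyap_N_eq_iff u[symmetric]
  proof
    have "transpose (Y 0 ** A + transpose A ** Y 0 + Z 0 ** Ad + transpose Ad ** Y h) = transpose (- mat 1)"
      using L by (simp add: Y_def Z_def)
    then show "unvec (upper (u 0)) ** A + transpose A ** unvec (upper (u 0)) + unvec (lower (u 0)) ** Ad
        + transpose Ad ** unvec (upper (u h)) = - mat 1"
      using B by (simp add: u_def unvec_vec_of transpose_add transpose_minus matrix_transpose_mul
          transpose_transpose Y_def[symmetric] Z_def[symmetric] transpose_mat algebra_simps)
    show "unvec (upper (u 0)) = unvec (lower (u h))"
      using B by (simp add: u_def unvec_vec_of Y_def Z_def)
  qed
  then have "u 0 = w" using inv by blast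
  then have "Z \<tau> = unvec (lower (u \<tau>))"
    by (simp add: YZ u[of \<tau>])
  then show "lyap_Z h A Ad \<tau> = transpose (lyap_Y h A Ad (h - \<tau>))"
    by (simp add: u_def unvec_vec_of Y_def Z_def)
qed

section \<open>Functions with a jump at the origin\<close>

text \<open>
  The class of functions in which trajectories live: a jump at \<open>0\<close> is allowed, since the value
  of the initial function at \<open>0\<close> is independent of its values before. To the left of \<open>0\<close> the function
  is required to agree with a function that is continuous on the whole line, which encodes the
  existence of the left limit and makes closure under products immediate.
\<close>

definition jump_cont :: "(real \<Rightarrow> 'a::topological_space) \<Rightarrow> bool" where
  "jump_cont f \<longleftrightarrow> (\<exists>g. continuous_on UNIV g \<and> (\<forall>s<0. f s = g s)) \<and> continuous_on {0..} f"

lemma jump_cont_continuous: "continuous_on UNIV f \<Longrightarrow> jump_cont f"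
  unfolding jump_cont_def
  by (intro conjI exI[of _ f]) (auto intro: continuous_on_subset)

lemma jump_cont_bilinear:
  assumes "bounded_bilinear B" "jump_cont f" "jump_cont g"
  shows "jump_cont (\<lambda>s. B (f s) (g s))"
proof -
  obtain f' g' where "continuous_on UNIV f'" "\<forall>s<0. f s = f' s" "continuous_on {0..} f"
      "continuous_on UNIV g'" "\<forall>s<0. g s = g' s" "continuous_on {0..} g"
    using assms unfolding jump_cont_def by metis
  then show ?thesis
    unfolding jump_cont_def
    by (intro conjI exI[of _ "\<lambda>s. B (f' s) (g' s)"] bounded_bilinear.continuous_on[OF assms(1)]) auto
qed

lemma jump_cont_linear:
  assumes "bounded_linear B" "jump_cont f"
  shows "jump_cont (\<lambda>s. B (f s))"
proof -
  obtain f' where "continuous_on UNIV f'" "\<forall>s<0. f s = f' s" "continuous_on {0..} f"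
    using assms unfolding jump_cont_def by metis
  then show ?thesis
    unfolding jump_cont_def
    by (intro conjI exI[of _ "\<lambda>s. B (f' s)"] bounded_linear.continuous_on[OF assms(1)]) auto
qed

lemma jump_cont_isCont:
  assumes "jump_cont f" "t \<noteq> 0"
  shows "isCont f t"
proof (cases "t < 0")
  case True
  obtain f' where f': "continuous_on UNIV f'" "\<forall>s<0. f s = f' s"
    using assms unfolding jump_cont_def by metis
  have "\<forall>\<^sub>F s in nhds t. f s = f' s"
    using True f'(2) by (intro eventually_nhds_in_open[of "{..<0}", THEN eventually_mono]) auto
  then show ?thesis
    using f'(1) by (simp add: isCont_cong continuous_on_eq_continuous_at)
next
  case False
  have "continuous_on {0<..} f"
    using assms unfolding jump_cont_def by (auto intro: continuous_on_subset)
  then show ?thesis using False assms(2) by (simp add: continuous_on_eq_continuous_at)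
qed

lemma jump_cont_integrable:
  fixes f :: "real \<Rightarrow> 'a::banach"
  assumes "jump_cont f"
  shows "f integrable_on {a..b}"
proof -
  obtain f' where f': "continuous_on UNIV f'" "\<forall>s<0. f s = f' s" and f: "continuous_on {0..} f"
    using assms unfolding jump_cont_def by metis
  have neg: "f integrable_on {c..0}" for c
  proof (rule integrable_spike_finite[of "{0}"])
    show "f' integrable_on {c..0}"
      using f'(1) by (intro integrable_continuous_real) (auto intro: continuous_on_subset)
  qed (use f' in auto)
  have pos: "f integrable_on {0..c}" for c
    using f by (intro integrable_continuous_real) (auto intro: continuous_on_subset)
  have "f integrable_on {min a 0..max b 0}"
    by (rule Henstock_Kurzweil_Integration.integrable_combine[of _ 0]) (auto intro: neg pos)
  then show ?thesis
    by (rule integrable_subinterval_real) auto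
qed

lemma jump_cont_integral_continuous:
  fixes f :: "real \<Rightarrow> 'a::banach"
  assumes "jump_cont f"
  shows "continuous_on {c..} (\<lambda>t. integral {c..t} f)"
  unfolding continuous_on_eq_continuous_within
proof
  fix t assume t: "t \<in> {c..}"
  have "continuous_on {c..t + 1} (\<lambda>t. integral {c..t} f)"
    by (intro indefinite_integral_continuous_1 jump_cont_integrable assms)
  then have "continuous (at t within {c..t + 1}) (\<lambda>t. integral {c..t} f)"
    using t by (simp add: continuous_on_eq_continuous_within)
  moreover have "at t within {c..t + 1} = at t within {c..}"
    by (rule at_within_nhd[of _ "{..<t + 1}"]) auto
  ultimately show "continuous (at t within {c..}) (\<lambda>t. integral {c..t} f)" by simp
qed

lemma jump_cont_integral_has_vector_derivative:
  fixes f :: "real \<Rightarrow> 'a::banach"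
  assumes "jump_cont f" "c < t" "t \<noteq> 0"
  shows "((\<lambda>t. integral {c..t} f) has_vector_derivative f t) (at t)"
proof -
  have "((\<lambda>t. integral {c..t} f) has_vector_derivative f t) (at t within {c..t + 1} - {})"
    using assms(2)
    by (intro integral_has_vector_derivative_continuous_at jump_cont_integrable[OF assms(1)]
        continuous_at_imp_continuous_at_within[OF jump_cont_isCont[OF assms(1,3)]]) auto
  moreover have "at t within {c..t + 1} = at t"
    using assms(2) by (intro at_within_interior) auto
  ultimately show ?thesis by simp
qed

section \<open>Existence of solutions\<close>

text \<open>
  The variation-of-constants formula, with the delayed values taken from a given function \<open>y\<close>.
  The integral is shifted to \<open>[-h, t - h]\<close> so that its integrand jumps at \<open>0\<close>, as \<open>y\<close> does.
\<close>

definition dde_step ::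
  "real \<Rightarrow> real^'m^'m \<Rightarrow> real^'m^'m \<Rightarrow> (real \<Rightarrow> real^'m) \<Rightarrow> real^'m \<Rightarrow> (real \<Rightarrow> real^'m) \<Rightarrow> real \<Rightarrow> real^'m"
where
  "dde_step h A Ad g v0 y t =
     (if t < 0 then g t
      else mexp (t *\<^sub>R A) *v
        (v0 + integral {-h..t - h} (\<lambda>s. mexp ((- (s + h)) *\<^sub>R A) *v (Ad *v y s))))"

lemma continuous_on_mexp_comp:
  fixes X :: "real^'k^'k"
  shows "continuous_on S f \<Longrightarrow> continuous_on S (\<lambda>s. mexp (f s *\<^sub>R X))"
  using continuous_on_compose2[OF continuous_on_mexp[of UNIV X], of S f] by simp

lemma jump_cont_dde_integrand:
  assumes "jump_cont y"
  shows "jump_cont (\<lambda>s. mexp ((- (s + h)) *\<^sub>R A) *v (Ad *v y s))"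
  by (intro jump_cont_bilinear[OF bounded_bilinear_matrix_vector_mult]
      jump_cont_continuous continuous_on_mexp_comp continuous_intros assms)

lemma jump_cont_dde_step:
  assumes "continuous_on UNIV g" "jump_cont y"
  shows "jump_cont (dde_step h A Ad g v0 y)"
proof -
  have "continuous_on {0..} (\<lambda>t. integral {-h..t - h} (\<lambda>s. mexp ((- (s + h)) *\<^sub>R A) *v (Ad *v y s)))"
    by (rule continuous_on_compose2[OF jump_cont_integral_continuous[OF jump_cont_dde_integrand[OF assms(2)]]])
      (auto intro!: continuous_intros)
  then have "continuous_on {0..} (\<lambda>t. mexp (t *\<^sub>R A) *v
        (v0 + integral {-h..t - h} (\<lambda>s. mexp ((- (s + h)) *\<^sub>R A) *v (Ad *v y s))))"
    by (intro bounded_bilinear.continuous_on[OF bounded_bilinear_matrix_vector_mult] continuous_on_mexp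
        continuous_intros)
  then have "continuous_on {0..} (dde_step h A Ad g v0 y)"
    by (rule continuous_on_eq) (simp add: dde_step_def)
  then show ?thesis
    using assms(1) unfolding jump_cont_def by (auto simp: dde_step_def)
qed

text \<open>
  The step looks back by \<open>h\<close>, so agreement up to time \<open>c\<close> improves to agreement up to \<open>c + h\<close>.
\<close>

lemma dde_step_cong:
  assumes "\<And>s. s \<le> c \<Longrightarrow> y s = z s" "t \<le> c + h"
  shows "dde_step h A Ad g v0 y t = dde_step h A Ad g v0 z t"
proof -
  have "integral {-h..t - h} (\<lambda>s. mexp ((- (s + h)) *\<^sub>R A) *v (Ad *v y s))
      = integral {-h..t - h} (\<lambda>s. mexp ((- (s + h)) *\<^sub>R A) *v (Ad *v z s))"
    using assms by (intro integral_cong) auto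
  then show ?thesis by (simp only: dde_step_def)
qed

text \<open>
  The method of steps as a fixed point iteration: each application of the step map freezes the
  iterates on one more interval of length \<open>h\<close>, hence they are eventually constant at each time. The
  limit inherits continuity from the iterates, and no pieces have to be glued together.
\<close>

lemma dde_step_fixpoint_exists:
  assumes "0 < h" "continuous_on UNIV g"
  obtains x where "jump_cont x" "x = dde_step h A Ad g v0 x"
proof -
  define F where "F = dde_step h A Ad g v0"
  define y where "y n = (F ^^ n) (\<lambda>t. if t < 0 then g t else v0)" for n :: nat
  have y_Suc: "y (Suc n) = F (y n)" for n by (simp add: y_def)
  have jc: "jump_cont (y n)" for n
  proof (induction n)
    case 0
    have "continuous_on {0..} (\<lambda>t. if t < 0 then g t else v0)"
      by (rule continuous_on_eq[OF continuous_on_const[of _ v0]]) auto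
    then show ?case
      unfolding jump_cont_def y_def using assms(2) by auto
  next
    case (Suc n)
    then show ?case unfolding y_Suc F_def by (rule jump_cont_dde_step[OF assms(2)])
  qed
  have stable1: "y (Suc n) t = y n t" if "t \<le> real n * h" for n t
    using that
  proof (induction n arbitrary: t)
    case 0
    then show ?case by (auto simp: y_def F_def dde_step_def mexp_0)
  next
    case (Suc n)
    have "F (y (Suc n)) t = F (y n) t"
      unfolding F_def by (rule dde_step_cong[OF Suc.IH]) (use Suc.prems in \<open>auto simp: algebra_simps\<close>)
    then show ?case by (simp only: y_Suc)
  qed
  have stable: "y (n + k) t = y n t" if "t \<le> real n * h" for n k t
  proof (induction k)
    case (Suc k)
    have "t \<le> real (n + k) * h"
      using that by (rule order_trans) (use assms(1) in \<open>auto intro: mult_right_mono\<close>)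
    then show ?case using Suc stable1[of t "n + k"] by simp
  qed simp
  define x where "x t = y (nat \<lceil>t / h\<rceil>) t" for t
  have x_eq: "x t = y n t" if "t \<le> real n * h" for n t
  proof -
    have "nat \<lceil>t / h\<rceil> \<le> n"
      using that assms(1) by (simp add: nat_le_iff ceiling_le_iff divide_le_eq)
    moreover have "t \<le> real (nat \<lceil>t / h\<rceil>) * h"
    proof -
      have "t / h \<le> real (nat \<lceil>t / h\<rceil>)" by linarith
      then show ?thesis using assms(1) by (simp add: divide_le_eq)
    qed
    ultimately show ?thesis
      unfolding x_def using stable[of t "nat \<lceil>t / h\<rceil>" "n - nat \<lceil>t / h\<rceil>"] by simp
  qed
  have large: "\<exists>n. t \<le> real n * h" for t
    using reals_Archimedean3[OF assms(1)] less_imp_le by blast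
  have fixpt: "x t = F x t" for t
  proof -
    obtain n where n: "t \<le> real n * h" using large by blast
    then have "x t = y (Suc n) t"
      using x_eq[OF n] stable1[OF n] by simp
    also have "\<dots> = F (y n) t" by (simp only: y_Suc)
    also have "\<dots> = F x t"
      unfolding F_def by (rule dde_step_cong[of "real n * h"]) (use n assms(1) in \<open>auto simp: x_eq\<close>)
    finally show ?thesis .
  qed
  have "continuous_on {0..} x"
    unfolding continuous_on_eq_continuous_within
  proof
    fix t :: real assume t: "t \<in> {0..}"
    obtain n where n: "t + 1 \<le> real n * h" using large by blast
    have "continuous_on {0..t + 1} (y n)"
      using jc[of n] unfolding jump_cont_def by (auto intro: continuous_on_subset)
    then have "continuous_on {0..t + 1} x"
      by (rule continuous_on_eq) (use n in \<open>auto intro!: x_eq[symmetric]\<close>)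
    then have "continuous (at t within {0..t + 1}) x"
      using t by (simp add: continuous_on_eq_continuous_within)
    moreover have "at t within {0..t + 1} = at t within {0..}"
      by (rule at_within_nhd[of _ "{..<t + 1}"]) auto
    ultimately show "continuous (at t within {0..}) x" by simp
  qed
  moreover have "x t = g t" if "t < 0" for t
    using that fixpt[of t] by (simp add: F_def dde_step_def)
  ultimately have "jump_cont x"
    unfolding jump_cont_def using assms(2) by blast
  with fixpt show ?thesis using that unfolding F_def by blast
qed

text \<open>
  At \<open>t = h\<close> the delayed term passes the jump of the initial function, so that the equation can
  fail there.
\<close>

lemma dde_solution_exists:
  fixes A Ad :: "real^'m^'m"
  assumes "0 < h" "continuous_on UNIV g"
  shows "\<exists>x. jump_cont x \<and> (\<forall>t<0. x t = g t) \<and> x 0 = v0 \<and>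
    (\<forall>t>0. t \<noteq> h \<longrightarrow> (x has_vector_derivative A *v x t + Ad *v x (t - h)) (at t))"
proof -
  obtain x where jc: "jump_cont x" and x: "x = dde_step h A Ad g v0 x"
    using dde_step_fixpoint_exists[OF assms] .
  define k where "k = (\<lambda>s. mexp ((- (s + h)) *\<^sub>R A) *v (Ad *v x s))"
  define z where "z t = mexp (t *\<^sub>R A) *v (v0 + integral {-h..t - h} k)" for t
  have xz: "x t = z t" if "0 \<le> t" for t
    using fun_cong[OF x, of t] that by (simp add: dde_step_def z_def k_def)
  have der: "(x has_vector_derivative A *v x t + Ad *v x (t - h)) (at t)" if "0 < t" "t \<noteq> h" for t
  proof -
    have "((\<lambda>t. t - h) has_vector_derivative 1) (at t)"
      by (auto intro!: derivative_eq_intros)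
    moreover have "((\<lambda>u. integral {-h..u} k) has_vector_derivative k (t - h)) (at (t - h))"
      unfolding k_def using that
      by (intro jump_cont_integral_has_vector_derivative jump_cont_dde_integrand jc) auto
    ultimately have "((\<lambda>t. integral {-h..t - h} k) has_vector_derivative k (t - h)) (at t)"
      using vector_diff_chain_at[of "\<lambda>t. t - h" 1 t "\<lambda>u. integral {-h..u} k"] by (simp add: o_def)
    then have "((\<lambda>t. v0 + integral {-h..t - h} k) has_vector_derivative 0 + k (t - h)) (at t)"
      by (intro has_vector_derivative_add has_vector_derivative_const)
    from bounded_bilinear.has_vector_derivative[OF bounded_bilinear_matrix_vector_mult
        mexp_has_vector_derivative this]
    have "(z has_vector_derivative mexp (t *\<^sub>R A) *v (0 + k (t - h))
        + (A ** mexp (t *\<^sub>R A)) *v (v0 + integral {-h..t - h} k)) (at t)"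
      unfolding z_def .
    moreover have "mexp (t *\<^sub>R A) *v k (t - h) = Ad *v x (t - h)"
      using mexp_mult_neg[of t A] by (simp add: k_def matrix_vector_mul_assoc matrix_mul_assoc)
    ultimately have "(z has_vector_derivative A *v x t + Ad *v x (t - h)) (at t)"
      using xz[of t] that by (simp add: z_def matrix_vector_mul_assoc[symmetric] add.commute)
    then show ?thesis
      by (rule has_vector_derivative_transform_within_open[of _ _ _ "{0<..}"]) (use that in \<open>auto simp: xz\<close>)
  qed
  have "x t = g t" if "t < 0" for t
    using that fun_cong[OF x, of t] by (simp add: dde_step_def)
  moreover have "x 0 = v0"
    by (simp add: xz z_def mexp_0)
  ultimately show ?thesis
    using jc der by blast
qed

section \<open>Exponential convolutions over a sliding window\<close>

lemma jump_cont_moment: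
  fixes X :: "real^'k^'k" and y :: "real \<Rightarrow> real^'n"
  assumes "jump_cont y"
  shows "jump_cont (\<lambda>s. (y s \<bullet> b) *\<^sub>R (mexp ((- s) *\<^sub>R X) *v w))"
  by (rule jump_cont_bilinear[OF bounded_bilinear_scaleR
        jump_cont_linear[OF bounded_linear_inner_left assms]
        jump_cont_bilinear[OF bounded_bilinear_matrix_vector_mult]])
    (intro jump_cont_continuous continuous_on_mexp_comp continuous_intros)+

text \<open>
  Since \<open>e\<^bsup>(t-s)X\<^esup> = e\<^bsup>tX\<^esup> e\<^bsup>-sX\<^esup>\<close>, the kernel separates into a finite sum of products of a factor
  depending on \<open>t\<close> and a factor depending on \<open>s\<close>. A convolution over a sliding window thereby
  becomes a combination of ordinary antiderivatives, for which continuity and differentiation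
  need no rule for integrals with a parameter.
\<close>

lemma separate_exponential_kernel:
  fixes X :: "real^'k^'k" and L :: "real^'k \<Rightarrow> real^'n \<Rightarrow> real^'p"
  assumes L: "bounded_bilinear L" and C: "bounded_linear C"
  shows "(\<Sum>b\<in>Basis. L (C (mexp (t *\<^sub>R X) *v ((v \<bullet> b) *\<^sub>R (mexp ((- s) *\<^sub>R X) *v w)))) b)
    = L (C (mexp ((t - s) *\<^sub>R X) *v w)) v"
proof -
  have "L (C (mexp (t *\<^sub>R X) *v ((v \<bullet> b) *\<^sub>R (mexp ((- s) *\<^sub>R X) *v w)))) b
      = L (C (mexp ((t - s) *\<^sub>R X) *v w)) ((v \<bullet> b) *\<^sub>R b)" for b
    by (simp add: mexp_diff_vec[of t s X w] matrix_vector_mult_scaleR linear_simps(5)[OF C]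
        bounded_bilinear.scaleR_left[OF L] bounded_bilinear.scaleR_right[OF L])
  then show ?thesis
    by (simp add: bounded_bilinear.sum_right[OF L, symmetric] euclidean_representation)
qed

text \<open>
  The additional linear map \<open>C\<close> lets the same representation serve for the convolution
  (\<open>C = id\<close>) and for the term that comes from differentiating its kernel (\<open>C = X\<close>).
\<close>

lemma window_conv_repr:
  fixes X :: "real^'k^'k" and y :: "real \<Rightarrow> real^'n" and L :: "real^'k \<Rightarrow> real^'n \<Rightarrow> real^'p" and w :: "real^'k"
  defines "G \<equiv> \<lambda>b s. (y s \<bullet> b) *\<^sub>R (mexp ((- s) *\<^sub>R X) *v w)"
  assumes L: "bounded_bilinear L" and C: "bounded_linear C" and y: "jump_cont y" and h: "0 < h" and t: "0 \<le> t"
  shows "((\<lambda>s. L (C (mexp ((t - s) *\<^sub>R X) *v w)) (y s)) has_integral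
    (\<Sum>b\<in>Basis. L (C (mexp (t *\<^sub>R X) *v (integral {-h..t} (G b) - integral {-h..t - h} (G b)))) b)) {t - h..t}"
proof -
  have jG: "jump_cont (G b)" for b
    unfolding G_def by (rule jump_cont_moment[OF y])
  have bl: "bounded_linear (\<lambda>g. L (C (mexp (t *\<^sub>R X) *v g)) b)" for b
    by (intro bounded_linear_compose[OF bounded_bilinear.bounded_linear_left[OF L]]
        bounded_linear_compose[OF C] matrix_vector_mul_bounded_linear)
  have int: "(G b has_integral integral {-h..t} (G b) - integral {-h..t - h} (G b)) {t - h..t}" for b
  proof -
    have "integral {-h..t - h} (G b) + integral {t - h..t} (G b) = integral {-h..t} (G b)"
      using h t by (intro Henstock_Kurzweil_Integration.integral_combine jump_cont_integrable jG) auto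
    moreover have "(G b has_integral integral {t - h..t} (G b)) {t - h..t}"
      by (intro integrable_integral jump_cont_integrable jG)
    ultimately show ?thesis by (metis add_diff_cancel_left')
  qed
  have "((\<lambda>s. \<Sum>b\<in>Basis. L (C (mexp (t *\<^sub>R X) *v G b s)) b) has_integral
    (\<Sum>b\<in>Basis. L (C (mexp (t *\<^sub>R X) *v (integral {-h..t} (G b) - integral {-h..t - h} (G b)))) b)) {t - h..t}"
    by (intro has_integral_sum has_integral_linear[OF int bl, unfolded o_def]) auto
  then show ?thesis
    unfolding G_def separate_exponential_kernel[OF L C] .
qed

lemma
  fixes X :: "real^'k^'k" and y :: "real \<Rightarrow> real^'n" and L :: "real^'k \<Rightarrow> real^'n \<Rightarrow> real^'p"
  assumes L: "bounded_bilinear L" and y: "jump_cont y" and h: "0 < h"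
  shows window_conv_continuous:
    "continuous_on {0..} (\<lambda>t. integral {t - h..t} (\<lambda>s. L (mexp ((t - s) *\<^sub>R X) *v w) (y s)))" (is ?cont)
    and window_conv_has_vector_derivative:
    "0 < t \<Longrightarrow> t \<noteq> h \<Longrightarrow>
     ((\<lambda>t. integral {t - h..t} (\<lambda>s. L (mexp ((t - s) *\<^sub>R X) *v w) (y s))) has_vector_derivative
        integral {t - h..t} (\<lambda>s. L (X *v (mexp ((t - s) *\<^sub>R X) *v w)) (y s))
        + L w (y t) - L (mexp (h *\<^sub>R X) *v w) (y (t - h))) (at t)" (is "_ \<Longrightarrow> _ \<Longrightarrow> ?deriv")
proof -
  define G where "G b s = (y s \<bullet> b) *\<^sub>R (mexp ((- s) *\<^sub>R X) *v w)" for b s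
  define \<omega> where "\<omega> b t = mexp (t *\<^sub>R X) *v (integral {-h..t} (G b) - integral {-h..t - h} (G b))" for b t
  have jG: "jump_cont (G b)" for b
    unfolding G_def by (rule jump_cont_moment[OF y])
  have repr: "integral {t - h..t} (\<lambda>s. L (C (mexp ((t - s) *\<^sub>R X) *v w)) (y s)) = (\<Sum>b\<in>Basis. L (C (\<omega> b t)) b)"
    if "bounded_linear C" "0 \<le> t" for C t
    using integral_unique[OF window_conv_repr[OF L that(1) y h that(2)]] unfolding \<omega>_def G_def .
  note repr_id = repr[OF bounded_linear_ident]
  have "continuous_on {0..} (\<omega> b)" for b
  proof -
    have "continuous_on {0..} (\<lambda>t. integral {-h..t} (G b))"
      by (rule continuous_on_subset[OF jump_cont_integral_continuous[OF jG]]) (use h in auto)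
    moreover have "continuous_on {0..} (\<lambda>t. integral {-h..t - h} (G b))"
      by (rule continuous_on_compose2[OF jump_cont_integral_continuous[OF jG]])
        (auto intro!: continuous_intros)
    ultimately show ?thesis
      unfolding \<omega>_def[abs_def]
      by (intro bounded_bilinear.continuous_on[OF bounded_bilinear_matrix_vector_mult] continuous_on_mexp
          continuous_intros)
  qed
  then have "continuous_on {0..} (\<lambda>t. \<Sum>b\<in>Basis. L (\<omega> b t) b)"
    by (intro continuous_on_sum bounded_bilinear.continuous_on[OF L] continuous_on_const)
  then show ?cont
    by (rule continuous_on_eq) (simp add: repr_id)
  show ?deriv if t: "0 < t" "t \<noteq> h"
  proof -
    have d\<omega>: "(\<omega> b has_vector_derivative mexp (t *\<^sub>R X) *v (G b t - G b (t - h)) + X *v \<omega> b t) (at t)" for b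
    proof -
      have d1: "((\<lambda>t. integral {-h..t} (G b)) has_vector_derivative G b t) (at t)"
        using t h by (intro jump_cont_integral_has_vector_derivative jG) auto
      have "((\<lambda>t. t - h) has_vector_derivative 1) (at t)"
        by (auto intro!: derivative_eq_intros)
      moreover have "((\<lambda>t. integral {-h..t} (G b)) has_vector_derivative G b (t - h)) (at (t - h))"
        using t h by (intro jump_cont_integral_has_vector_derivative jG) auto
      ultimately have d2: "((\<lambda>t. integral {-h..t - h} (G b)) has_vector_derivative G b (t - h)) (at t)"
        using vector_diff_chain_at[of "\<lambda>t. t - h" 1 t "\<lambda>u. integral {-h..u} (G b)"] by (simp add: o_def)
      from bounded_bilinear.has_vector_derivative[OF bounded_bilinear_matrix_vector_mult
          mexp_has_vector_derivative has_vector_derivative_diff[OF d1 d2]]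
      show ?thesis
        unfolding \<omega>_def[abs_def] by (simp add: matrix_vector_mul_assoc)
    qed
    have "((\<lambda>t. \<Sum>b\<in>Basis. L (\<omega> b t) b) has_vector_derivative
        (\<Sum>b\<in>Basis. L (mexp (t *\<^sub>R X) *v (G b t - G b (t - h)) + X *v \<omega> b t) b)) (at t)"
      by (intro has_vector_derivative_sum
          bounded_linear.has_vector_derivative[OF bounded_bilinear.bounded_linear_left[OF L]] d\<omega>)
    moreover have "(\<Sum>b\<in>Basis. L (mexp (t *\<^sub>R X) *v (G b t - G b (t - h)) + X *v \<omega> b t) b)
        = integral {t - h..t} (\<lambda>s. L (X *v (mexp ((t - s) *\<^sub>R X) *v w)) (y s))
        + L w (y t) - L (mexp (h *\<^sub>R X) *v w) (y (t - h))"
    proof -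
      have G: "(\<Sum>b\<in>Basis. L (mexp (t *\<^sub>R X) *v G b s) b) = L (mexp ((t - s) *\<^sub>R X) *v w) (y s)" for s
        unfolding G_def by (rule separate_exponential_kernel[OF L bounded_linear_ident])
      show ?thesis
        using t G[of t] G[of "t - h"]
        by (simp add: repr[OF matrix_vector_mul_bounded_linear] matrix_vector_mult_diff_distrib
            bounded_bilinear.add_left[OF L] bounded_bilinear.diff_left[OF L] sum.distrib sum_subtractf mexp_0)
    qed
    ultimately have "((\<lambda>t. \<Sum>b\<in>Basis. L (\<omega> b t) b) has_vector_derivative
        integral {t - h..t} (\<lambda>s. L (X *v (mexp ((t - s) *\<^sub>R X) *v w)) (y s))
        + L w (y t) - L (mexp (h *\<^sub>R X) *v w) (y (t - h))) (at t)" by simp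
    then show ?thesis
      by (rule has_vector_derivative_transform_within_open[of _ _ _ "{0<..}"])
        (use t in \<open>auto simp: repr_id\<close>)
  qed
qed

section \<open>The costate and the energy balance\<close>

lemma has_vector_derivative_lyap_Y:
  "(lyap_Y h A Ad has_vector_derivative lyap_Y h A Ad \<tau> ** A + lyap_Z h A Ad \<tau> ** Ad) (at \<tau>)"
  using has_vector_derivative_lyap(1)[where w = "lyap_w h A Ad"]
  by (simp add: lyap_Y_def[abs_def] lyap_Z_def)

lemma continuous_on_lyap_Y: "continuous_on S (lyap_Y h A Ad)"
  by (rule continuous_on_vector_derivative, rule has_vector_derivative_at_within,
      rule has_vector_derivative_lyap_Y)

lemma continuous_on_lyap_Z: "continuous_on S (lyap_Z h A Ad)"
  unfolding lyap_Z_def[abs_def]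
  by (intro bounded_linear.continuous_on[OF bounded_linear_unvec_lower] continuous_on_mexp
      bounded_bilinear.continuous_on[OF bounded_bilinear_matrix_vector_mult] continuous_on_const)

lemma jump_cont_matrix_vector:
  fixes K :: "real \<Rightarrow> real^'n^'k"
  shows "continuous_on UNIV K \<Longrightarrow> jump_cont v \<Longrightarrow> jump_cont (\<lambda>s. K s *v v s)"
  by (rule jump_cont_bilinear[OF bounded_bilinear_matrix_vector_mult jump_cont_continuous])

locale dde_trajectory =
  fixes h :: real and A Ad :: "real^'m^'m" and x :: "real \<Rightarrow> real^'m"
  assumes h_pos: "0 < h"
    and N_invertible: "invertible (lyap_N h A Ad)"
    and x_jump_cont: "jump_cont x"
    and x_derivative:
      "\<And>t. 0 < t \<Longrightarrow> t \<noteq> h \<Longrightarrow> (x has_vector_derivative A *v x t + Ad *v x (t - h)) (at t)"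
begin

abbreviation "Y \<equiv> lyap_Y h A Ad"
abbreviation "Z \<equiv> lyap_Z h A Ad"

text \<open>
  Half the gradient of the Lyapunov-Krasovskii functional with respect to the value \<open>x(t)\<close>.
\<close>

definition costate :: "real \<Rightarrow> real^'m" where
  "costate t = Y 0 *v x t + integral {t - h..t} (\<lambda>s. Z (t - s) *v (Ad *v x s))"

lemma jump_cont_Ad_x: "jump_cont (\<lambda>s. Ad *v x s)"
  by (rule jump_cont_linear[OF matrix_vector_mul_bounded_linear x_jump_cont])

lemma jump_cont_Z: "jump_cont (\<lambda>s. Z (c - s) *v (Ad *v x s))"
  by (intro jump_cont_matrix_vector jump_cont_Ad_x continuous_on_compose2[OF continuous_on_lyap_Z[of UNIV]]
      continuous_intros) auto

lemma jump_cont_Y: "jump_cont (\<lambda>s. Y (c - s) *v (Ad *v x s))"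
  by (intro jump_cont_matrix_vector jump_cont_Ad_x continuous_on_compose2[OF continuous_on_lyap_Y[of UNIV]]
      continuous_intros) auto

lemma x_continuous: "continuous_on {0..} x"
  using x_jump_cont by (simp add: jump_cont_def)

text \<open>
  Integration of \<open>(Y(c - s) x(s))' = Y(c - s) A\<^sub>d x(s - h) - Z(c - s) A\<^sub>d x(s)\<close>, in which
  the terms with \<open>A\<close> cancel.
\<close>

lemma transport:
  assumes "0 \<le> a" "a \<le> b"
  shows "Y (c - b) *v x b - Y (c - a) *v x a =
    integral {a - h..b - h} (\<lambda>s. Y (c - h - s) *v (Ad *v x s))
    - integral {a..b} (\<lambda>s. Z (c - s) *v (Ad *v x s))"
proof -
  have "((\<lambda>s. Y (c - s) *v (Ad *v x (s - h)) - Z (c - s) *v (Ad *v x s)) has_integral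
      Y (c - b) *v x b - Y (c - a) *v x a) {a..b}"
  proof (rule fundamental_theorem_of_calculus_interior_strong[of "{h}"])
    show "continuous_on {a..b} (\<lambda>s. Y (c - s) *v x s)"
      using assms
      by (intro bounded_bilinear.continuous_on[OF bounded_bilinear_matrix_vector_mult]
          continuous_on_compose2[OF continuous_on_lyap_Y[of UNIV]] continuous_intros
          continuous_on_subset[OF x_continuous]) auto
    fix s assume s: "s \<in> {a<..<b} - {h}"
    have "((\<lambda>s. c - s) has_vector_derivative - 1) (at s)"
      by (auto intro!: derivative_eq_intros)
    from vector_diff_chain_at[OF this has_vector_derivative_lyap_Y[of h A Ad]]
    have "((\<lambda>s. Y (c - s)) has_vector_derivative - (Y (c - s) ** A + Z (c - s) ** Ad)) (at s)"
      by (simp add: o_def)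
    from bounded_bilinear.has_vector_derivative[OF bounded_bilinear_matrix_vector_mult this x_derivative]
    have "((\<lambda>s. Y (c - s) *v x s) has_vector_derivative
        Y (c - s) *v (A *v x s + Ad *v x (s - h)) + - (Y (c - s) ** A + Z (c - s) ** Ad) *v x s) (at s)"
      using s assms by simp
    moreover have "Y (c - s) *v (A *v x s + Ad *v x (s - h)) + - (Y (c - s) ** A + Z (c - s) ** Ad) *v x s
        = Y (c - s) *v (Ad *v x (s - h)) - Z (c - s) *v (Ad *v x s)"
      by (simp add: matrix_vector_right_distrib matrix_vector_mult_add_rdistrib matrix_vector_mul_assoc
          matrix_vector_mult_diff_rdistrib bounded_bilinear.minus_left[OF bounded_bilinear_matrix_vector_mult])
    ultimately show "((\<lambda>s. Y (c - s) *v x s) has_vector_derivative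
        Y (c - s) *v (Ad *v x (s - h)) - Z (c - s) *v (Ad *v x s)) (at s)"
      by simp
  qed (use assms in auto)
  moreover have "((\<lambda>s. Y (c - s) *v (Ad *v x (s - h))) has_integral
      integral {a - h..b - h} (\<lambda>s. Y (c - h - s) *v (Ad *v x s))) {a..b}"
  proof -
    have "((\<lambda>s. Y (c - h - (s + - h)) *v (Ad *v x (s + - h))) has_integral
        integral {a - h..b - h} (\<lambda>s. Y (c - h - s) *v (Ad *v x s))) {a - h - - h..b - h - - h}"
      by (rule has_integral_shift_real_ivl) (intro integrable_integral jump_cont_integrable jump_cont_Y)
    then show ?thesis by simp
  qed
  moreover have "((\<lambda>s. Z (c - s) *v (Ad *v x s)) has_integral
      integral {a..b} (\<lambda>s. Z (c - s) *v (Ad *v x s))) {a..b}"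
    by (intro integrable_integral jump_cont_integrable jump_cont_Z)
  ultimately show ?thesis
    using has_integral_diff has_integral_unique by blast
qed

text \<open>
  The costate at a time \<open>a + r\<close> is determined by the state at the earlier time \<open>a\<close>, if \<open>r \<le> h\<close>.
  Two cases matter: \<open>r = h\<close> identifies the term of the derivative of the costate that looks
  ahead, and \<open>a = 0\<close> expresses the costate on \<open>[0, h]\<close> through the initial data.
\<close>

lemma costate_advance:
  assumes "0 \<le> a" "0 \<le> r" "r \<le> h"
  shows "costate (a + r) = Y r *v x a
    + integral {a - h..a + r - h} (\<lambda>s. Y (a + r - h - s) *v (Ad *v x s))
    + integral {a + r - h..a} (\<lambda>s. Z (a + r - s) *v (Ad *v x s))"
proof -
  have combine: "integral {a + r - h..a} (\<lambda>s. Z (a + r - s) *v (Ad *v x s))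
      + integral {a..a + r} (\<lambda>s. Z (a + r - s) *v (Ad *v x s))
      = integral {a + r - h..a + r} (\<lambda>s. Z (a + r - s) *v (Ad *v x s))"
    using assms by (intro Henstock_Kurzweil_Integration.integral_combine jump_cont_integrable jump_cont_Z) auto
  have "Y 0 *v x (a + r) = Y r *v x a
    + integral {a - h..a + r - h} (\<lambda>s. Y (a + r - h - s) *v (Ad *v x s))
    - integral {a..a + r} (\<lambda>s. Z (a + r - s) *v (Ad *v x s))"
    using transport[of a "a + r" "a + r"] assms by (simp add: diff_eq_eq)
  then show ?thesis
    unfolding costate_def combine[symmetric] by simp
qed

lemma costate_continuous: "continuous_on {0..} costate"
proof -
  have bil: "bounded_bilinear (\<lambda>(u :: real^('m \<times> 'm + 'm \<times> 'm)) v. unvec (lower u) *v v)"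
    by (rule bounded_bilinear.comp1[OF bounded_bilinear_matrix_vector_mult bounded_linear_unvec_lower])
  from window_conv_continuous[OF this jump_cont_Ad_x h_pos]
  have "continuous_on {0..} (\<lambda>t. integral {t - h..t} (\<lambda>s. Z (t - s) *v (Ad *v x s)))"
    by (simp add: lyap_Z_def)
  then show ?thesis
    unfolding costate_def[abs_def]
    by (intro continuous_on_add bounded_linear.continuous_on[OF matrix_vector_mul_bounded_linear] x_continuous)
qed

text \<open>
  The adjoint equation, which is advanced where the system is delayed. In the derivative of the
  convolution the boundary term \<open>Z(h) A\<^sub>d x(t - h)\<close> cancels against the delayed part of \<open>U(0) x'\<close>
  because \<open>Z(h) = Y(0)\<close>; the integral over \<open>Y\<close> completes to the costate at \<open>t + h\<close>; and the
  Lyapunov equation collects the remaining terms in \<open>x(t)\<close> to \<open>- x(t)\<close>.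
\<close>

lemma costate_has_vector_derivative:
  assumes "0 < t" "t \<noteq> h"
  shows "(costate has_vector_derivative
    - x t - transpose A *v costate t - transpose Ad *v costate (t + h)) (at t)"
proof -
  have bil: "bounded_bilinear (\<lambda>(u :: real^('m \<times> 'm + 'm \<times> 'm)) v. unvec (lower u) *v v)"
    by (rule bounded_bilinear.comp1[OF bounded_bilinear_matrix_vector_mult bounded_linear_unvec_lower])
  define \<zeta> where "\<zeta> t = integral {t - h..t} (\<lambda>s. Z (t - s) *v (Ad *v x s))" for t
  define \<rho> where "\<rho> = integral {t - h..t} (\<lambda>s. Y (t - s) *v (Ad *v x s))"
  have "(\<zeta> has_vector_derivative integral {t - h..t}
      (\<lambda>s. (- (transpose Ad ** Y (t - s)) - transpose A ** Z (t - s)) *v (Ad *v x s))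
      + Z 0 *v (Ad *v x t) - Z h *v (Ad *v x (t - h))) (at t)"
    using window_conv_has_vector_derivative[OF bil jump_cont_Ad_x h_pos assms,
        where X = "lyap_M A Ad" and w = "lyap_w h A Ad"]
    by (simp add: unvec_lower_lyap_M lyap_Y_def lyap_Z_def \<zeta>_def[abs_def] mexp_0)
  moreover have "integral {t - h..t}
      (\<lambda>s. (- (transpose Ad ** Y (t - s)) - transpose A ** Z (t - s)) *v (Ad *v x s))
      = - (transpose Ad *v \<rho>) - transpose A *v \<zeta> t"
  proof -
    have "((\<lambda>s. - (transpose Ad *v (Y (t - s) *v (Ad *v x s)))
          - transpose A *v (Z (t - s) *v (Ad *v x s))) has_integral
        - (transpose Ad *v \<rho>) - transpose A *v \<zeta> t) {t - h..t}"
      unfolding \<rho>_def \<zeta>_def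
      by (intro has_integral_diff has_integral_neg has_integral_linear[OF _ matrix_vector_mul_bounded_linear, unfolded o_def]
          integrable_integral jump_cont_integrable jump_cont_Y jump_cont_Z)
    moreover have "(- (transpose Ad ** Y (t - s)) - transpose A ** Z (t - s)) *v v
        = - (transpose Ad *v (Y (t - s) *v v)) - transpose A *v (Z (t - s) *v v)" for s v
      by (simp add: matrix_vector_mult_diff_rdistrib matrix_vector_mul_assoc
          bounded_bilinear.minus_left[OF bounded_bilinear_matrix_vector_mult]
          del: transpose_matrix_vector)
    ultimately show ?thesis
      by (simp only: integral_unique)
  qed
  ultimately have d\<zeta>: "(\<zeta> has_vector_derivative - (transpose Ad *v \<rho>) - transpose A *v \<zeta> t
      + Z 0 *v (Ad *v x t) - Y 0 *v (Ad *v x (t - h))) (at t)"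
    by (simp add: lyap_YZ_boundary[OF N_invertible])
  have "(costate has_vector_derivative Y 0 *v (A *v x t + Ad *v x (t - h))
      + (- (transpose Ad *v \<rho>) - transpose A *v \<zeta> t
      + Z 0 *v (Ad *v x t) - Y 0 *v (Ad *v x (t - h)))) (at t)"
    unfolding costate_def[abs_def] \<zeta>_def[symmetric]
    by (intro has_vector_derivative_add d\<zeta> x_derivative assms
        bounded_linear.has_vector_derivative[OF matrix_vector_mul_bounded_linear])
  moreover have "Y 0 *v (A *v x t + Ad *v x (t - h))
      + (- (transpose Ad *v \<rho>) - transpose A *v \<zeta> t + Z 0 *v (Ad *v x t) - Y 0 *v (Ad *v x (t - h)))
      = - x t - transpose A *v costate t - transpose Ad *v costate (t + h)"
  proof -
    have eta: "costate t = Y 0 *v x t + \<zeta> t"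
      by (simp add: costate_def \<zeta>_def)
    have eta_h: "costate (t + h) = Y h *v x t + \<rho>"
      using costate_advance[of t h] assms h_pos by (simp add: \<rho>_def)
    have "(Y 0 ** A + transpose A ** Y 0 + Z 0 ** Ad + transpose Ad ** Y h) *v x t = (- mat 1) *v x t"
      by (simp only: lyap_YZ_lyapunov[OF N_invertible])
    then have "Y 0 *v (A *v x t) + transpose A *v (Y 0 *v x t) + Z 0 *v (Ad *v x t)
        + transpose Ad *v (Y h *v x t) = - x t"
      by (simp add: matrix_vector_mult_add_rdistrib matrix_vector_mul_assoc
          bounded_bilinear.minus_left[OF bounded_bilinear_matrix_vector_mult]
          del: transpose_matrix_vector)
    then show ?thesis
      unfolding eta eta_h matrix_vector_right_distrib
      by (simp add: algebra_simps add_eq_0_iff del: transpose_matrix_vector)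
  qed
  ultimately show ?thesis by simp
qed

lemma inner_costate_has_vector_derivative:
  assumes "0 < t" "t \<noteq> h"
  shows "((\<lambda>t. x t \<bullet> costate t) has_vector_derivative
    (Ad *v x (t - h)) \<bullet> costate t - (Ad *v x t) \<bullet> costate (t + h) - x t \<bullet> x t) (at t)"
proof -
  have "((\<lambda>t. x t \<bullet> costate t) has_vector_derivative
    x t \<bullet> (- x t - transpose A *v costate t - transpose Ad *v costate (t + h))
    + (A *v x t + Ad *v x (t - h)) \<bullet> costate t) (at t)"
    by (intro bounded_bilinear.has_vector_derivative[OF bounded_bilinear_inner]
        x_derivative costate_has_vector_derivative assms)
  moreover have "x t \<bullet> (transpose B *v v) = (B *v x t) \<bullet> v" for B :: "real^'m^'m" and v
    using dot_lmul_matrix[of "x t" "transpose B" v] by (simp add: transpose_transpose)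
  ultimately show ?thesis
    by (simp add: inner_diff_right inner_add_left algebra_simps)
qed

text \<open>
  Only times \<open>u \<ge> -h\<close> matter. The costate is continuous on \<open>[0, \<infinity>)\<close>, and clamping its argument
  keeps this function integrable on every interval.
\<close>

definition delayed_pairing :: "real \<Rightarrow> real" where
  "delayed_pairing u = (Ad *v x u) \<bullet> costate (max (u + h) 0)"

lemma jump_cont_delayed_pairing: "jump_cont delayed_pairing"
  unfolding delayed_pairing_def[abs_def]
  by (intro jump_cont_bilinear[OF bounded_bilinear_inner] jump_cont_Ad_x jump_cont_continuous
      continuous_on_compose2[OF costate_continuous] continuous_intros) auto

text \<open>
  The derivative of \<open>x \<bullet> \<eta>\<close> contains the pairing at the times \<open>t - h\<close> and \<open>t\<close> with opposite
  signs; after integration the two contributions cancel except for one window at each end.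
\<close>

lemma energy_balance:
  assumes "0 \<le> T"
  shows "x 0 \<bullet> costate 0 + integral {-h..0} delayed_pairing =
    x T \<bullet> costate T + integral {T - h..T} delayed_pairing + integral {0..T} (\<lambda>t. x t \<bullet> x t)"
proof -
  let ?q = delayed_pairing
  have a1: "((\<lambda>t. (Ad *v x (t - h)) \<bullet> costate t - (Ad *v x t) \<bullet> costate (t + h) - x t \<bullet> x t) has_integral
      x T \<bullet> costate T - x 0 \<bullet> costate 0) {0..T}"
  proof (rule fundamental_theorem_of_calculus_interior_strong[of "{h}"])
    show "continuous_on {0..T} (\<lambda>t. x t \<bullet> costate t)"
      by (intro continuous_intros continuous_on_subset[OF x_continuous] continuous_on_subset[OF costate_continuous]) auto
  qed (use assms inner_costate_has_vector_derivative in auto)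
  have a2: "((\<lambda>t. (Ad *v x (t - h)) \<bullet> costate t) has_integral integral {-h..T - h} ?q) {0..T}"
  proof -
    have "((\<lambda>t. ?q (t - h)) has_integral integral {-h..T - h} ?q) {0..T}"
    proof -
      have "((\<lambda>t. ?q (t + - h)) has_integral integral {-h..T - h} ?q) {- h - - h..T - h - - h}"
        by (rule has_integral_shift_real_ivl)
          (intro integrable_integral jump_cont_integrable jump_cont_delayed_pairing)
      then show ?thesis by simp
    qed
    then show ?thesis
      by (rule has_integral_eq[rotated]) (simp add: delayed_pairing_def)
  qed
  have a3: "((\<lambda>t. (Ad *v x t) \<bullet> costate (t + h)) has_integral integral {0..T} ?q) {0..T}"
    by (rule has_integral_eq[OF _ integrable_integral[OF jump_cont_integrable[OF jump_cont_delayed_pairing]]])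
      (use h_pos in \<open>simp add: delayed_pairing_def\<close>)
  have a4: "((\<lambda>t. x t \<bullet> x t) has_integral integral {0..T} (\<lambda>t. x t \<bullet> x t)) {0..T}"
    by (intro integrable_integral integrable_continuous_real continuous_intros
        continuous_on_subset[OF x_continuous]) auto
  have "x T \<bullet> costate T - x 0 \<bullet> costate 0 =
      integral {-h..T - h} ?q - integral {0..T} ?q - integral {0..T} (\<lambda>t. x t \<bullet> x t)"
    by (rule has_integral_unique[OF a1 has_integral_diff[OF has_integral_diff[OF a2 a3] a4]])
  moreover have "integral {-h..c} ?q + integral {c..T} ?q = integral {-h..T} ?q" if "-h \<le> c" "c \<le> T" for c
    by (rule Henstock_Kurzweil_Integration.integral_combine[OF that
          jump_cont_integrable[OF jump_cont_delayed_pairing]])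
  from this[of "T - h"] this[of 0] assms h_pos
  have "integral {-h..T - h} ?q + integral {T - h..T} ?q = integral {-h..0} ?q + integral {0..T} ?q"
    by simp
  ultimately show ?thesis by simp
qed

end

context dde_trajectory
begin

text \<open>
  The energy stored at time \<open>T\<close> is quadratic in the state and involves the trajectory from \<open>T - h\<close>
  on only.
\<close>

lemma remainder_bound:
  obtains C where "0 \<le> C" and
    "\<And>T \<epsilon>. 0 \<le> T \<Longrightarrow> (\<And>s. T - h \<le> s \<Longrightarrow> norm (x s) \<le> \<epsilon>) \<Longrightarrow>
      \<bar>x T \<bullet> costate T + integral {T - h..T} delayed_pairing\<bar> \<le> C * \<epsilon>\<^sup>2"
proof -
  obtain K where K: "0 < K" "\<And>(M :: real^'m^'m) (v :: real^'m). norm (M *v v) \<le> norm M * norm v * K"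
    using bounded_bilinear.pos_bounded[OF bounded_bilinear_matrix_vector_mult] by metis
  have "bounded (Z ` {0..h})"
    by (intro compact_imp_bounded compact_continuous_image continuous_on_lyap_Z compact_Icc)
  then obtain b where "\<forall>M\<in>Z ` {0..h}. norm M \<le> b"
    unfolding bounded_iff by blast
  then have b: "norm (Z \<tau>) \<le> b" if "\<tau> \<in> {0..h}" for \<tau>
    using that by blast
  have b0: "0 \<le> b" using order_trans[OF norm_ge_zero b[of 0]] h_pos by simp
  define a where "a = norm Ad * K"
  have a: "0 \<le> a" "norm (Ad *v v) \<le> a * norm v" for v
    using K unfolding a_def by (auto simp: mult_ac)
  define D where "D = norm (Y 0) * K + h * (b * K * a)"
  have D: "0 \<le> D" using K a b0 h_pos by (simp add: D_def)
  show ?thesis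
  proof (rule that[of "D + h * (a * D)"])
    show "0 \<le> D + h * (a * D)" using D a h_pos by simp
    fix T \<epsilon> assume T: "0 \<le> T" and x: "\<And>s. T - h \<le> s \<Longrightarrow> norm (x s) \<le> \<epsilon>"
    have \<epsilon>: "0 \<le> \<epsilon>" using x[of T] norm_ge_zero[of "x T"] h_pos by linarith
    have Ax: "norm (Ad *v x s) \<le> a * \<epsilon>" if "T - h \<le> s" for s
      using a(2)[of "x s"] mult_left_mono[OF x[OF that] a(1)] by linarith
    have eta: "norm (costate t) \<le> D * \<epsilon>" if "T \<le> t" for t
    proof -
      have "norm (Y 0 *v x t) \<le> norm (Y 0) * K * \<epsilon>"
      proof -
        have "norm (Y 0) * K * norm (x t) \<le> norm (Y 0) * K * \<epsilon>"
          using that K(1) h_pos by (intro mult_left_mono x) auto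
        then show ?thesis
          using K(2)[of "Y 0" "x t"] by (simp add: mult_ac)
      qed
      moreover have "norm (integral {t - h..t} (\<lambda>s. Z (t - s) *v (Ad *v x s))) \<le> integral {t - h..t} (\<lambda>s. b * K * (a * \<epsilon>))"
      proof (rule integral_norm_bound_integral)
        fix s assume s: "s \<in> {t - h..t}"
        have "norm (Z (t - s) *v (Ad *v x s)) \<le> norm (Z (t - s)) * norm (Ad *v x s) * K"
          by (rule K(2))
        also have "\<dots> \<le> b * (a * \<epsilon>) * K"
          using s that K(1) b[of "t - s"] b0 by (intro mult_right_mono mult_mono Ax) auto
        finally show "norm (Z (t - s) *v (Ad *v x s)) \<le> b * K * (a * \<epsilon>)"
          by (simp add: mult_ac)
      qed (auto intro: jump_cont_integrable jump_cont_Z)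
      ultimately show ?thesis
        using norm_triangle_ineq[of "Y 0 *v x t" "integral {t - h..t} (\<lambda>s. Z (t - s) *v (Ad *v x s))"] h_pos
        by (simp add: costate_def D_def algebra_simps)
    qed
    have "\<bar>x T \<bullet> costate T\<bar> \<le> \<epsilon> * (D * \<epsilon>)"
      using Cauchy_Schwarz_ineq2[of "x T" "costate T"] mult_mono[OF x[of T] eta[of T]] h_pos \<epsilon>
      by auto
    moreover have "norm (integral {T - h..T} delayed_pairing) \<le> integral {T - h..T} (\<lambda>u. a * \<epsilon> * (D * \<epsilon>))"
    proof (rule integral_norm_bound_integral)
      fix u assume u: "u \<in> {T - h..T}"
      show "norm (delayed_pairing u) \<le> a * \<epsilon> * (D * \<epsilon>)"
        unfolding delayed_pairing_def real_norm_def
        using u T a(1) \<epsilon>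
        by (intro order_trans[OF Cauchy_Schwarz_ineq2] mult_mono Ax eta) auto
    qed (auto intro: jump_cont_integrable jump_cont_delayed_pairing)
    ultimately show "\<bar>x T \<bullet> costate T + integral {T - h..T} delayed_pairing\<bar>
        \<le> (D + h * (a * D)) * \<epsilon>\<^sup>2"
      using h_pos by (simp add: power2_eq_square algebra_simps abs_le_iff)
  qed
qed

text \<open>
  In the energy balance the stored energy at \<open>T\<close> vanishes as \<open>T\<close> grows, and the dissipated energy
  up to \<open>T\<close> is at least the dissipated energy up to \<open>1\<close>. The time \<open>1\<close> is arbitrary.
\<close>

lemma energy_lower_bound:
  assumes "(x \<longlongrightarrow> 0) at_top"
  shows "integral {0..1} (\<lambda>t. x t \<bullet> x t) \<le> x 0 \<bullet> costate 0 + integral {-h..0} delayed_pairing"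
proof (rule field_le_epsilon)
  fix e :: real assume e: "0 < e"
  obtain C where C: "0 \<le> C" 
    "\<And>T \<epsilon>. 0 \<le> T \<Longrightarrow> (\<And>s. T - h \<le> s \<Longrightarrow> norm (x s) \<le> \<epsilon>) \<Longrightarrow>
      \<bar>x T \<bullet> costate T + integral {T - h..T} delayed_pairing\<bar> \<le> C * \<epsilon>\<^sup>2"
    using remainder_bound by blast
  \<comment> \<open>the summand \<open>1\<close> covers the case \<open>C = 0\<close>\<close>
  define \<epsilon> where "\<epsilon> = sqrt (e / (C + 1))"
  have \<epsilon>: "0 < \<epsilon>" "C * \<epsilon>\<^sup>2 \<le> e"
    using e C(1) by (simp_all add: \<epsilon>_def field_simps)
  obtain T0 where T0: "\<And>s. T0 \<le> s \<Longrightarrow> norm (x s) < \<epsilon>"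
    using tendstoD[OF assms \<epsilon>(1)] by (auto simp: eventually_at_top_linorder)
  define T where "T = max 1 (T0 + h)"
  have T: "1 \<le> T" "T0 + h \<le> T" by (simp_all add: T_def)
  have "\<bar>x T \<bullet> costate T + integral {T - h..T} delayed_pairing\<bar> \<le> e"
    using C(2)[of T \<epsilon>] T0 T \<epsilon>(2) by (force intro: less_imp_le)
  moreover have "integral {0..1} (\<lambda>t. x t \<bullet> x t) \<le> integral {0..T} (\<lambda>t. x t \<bullet> x t)"
    using T by (intro integral_subset_le integrable_continuous_real continuous_intros
        continuous_on_subset[OF x_continuous]) auto
  ultimately show "integral {0..1} (\<lambda>t. x t \<bullet> x t)
      \<le> x 0 \<bullet> costate 0 + integral {-h..0} delayed_pairing + e"
    using energy_balance[of T] T by simp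
qed

lemma initial_energy_nonneg:
  assumes "(x \<longlongrightarrow> 0) at_top"
  shows "0 \<le> x 0 \<bullet> costate 0 + integral {-h..0} delayed_pairing"
    and "x 0 \<noteq> 0 \<Longrightarrow> 0 < x 0 \<bullet> costate 0 + integral {-h..0} delayed_pairing"
proof -
  have cont: "continuous_on {0..1} (\<lambda>t. x t \<bullet> x t)"
    by (intro continuous_intros continuous_on_subset[OF x_continuous]) auto
  have nonneg: "0 \<le> integral {0..1} (\<lambda>t. x t \<bullet> x t)"
    by (intro integral_nonneg integrable_continuous_real cont) auto
  then show "0 \<le> x 0 \<bullet> costate 0 + integral {-h..0} delayed_pairing"
    using energy_lower_bound[OF assms] by linarith
  show "0 < x 0 \<bullet> costate 0 + integral {-h..0} delayed_pairing" if "x 0 \<noteq> 0"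
  proof -
    have "integral {0..1} (\<lambda>t. x t \<bullet> x t) \<noteq> 0"
    proof
      assume "integral {0..1} (\<lambda>t. x t \<bullet> x t) = 0"
      then have "((\<lambda>t. x t \<bullet> x t) has_integral 0) (cbox 0 1)"
        using integrable_integral[OF integrable_continuous_real[OF cont]] by simp
      from has_integral_0_cbox_imp_0[OF _ _ this, of 0] cont have "x 0 \<bullet> x 0 = 0"
        by simp
      then show False using that by simp
    qed
    then show ?thesis
      using nonneg energy_lower_bound[OF assms] by linarith
  qed
qed

text \<open>
  On \<open>[0, h]\<close> the costate depends on the initial data only, and the two convolutions with \<open>Y\<close> and
  \<open>Z\<close> that express it join to one integral over the history, whose kernel is \<open>U(u - s)\<close>.
\<close>

lemma initial_energy_eq:
  assumes g: "\<And>t. t < 0 \<Longrightarrow> x t = g t"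
  shows "x 0 \<bullet> costate 0 + integral {-h..0} delayed_pairing =
    x 0 \<bullet> (Y 0 *v x 0) + x 0 \<bullet> integral {-h..0} (\<lambda>s. Z (- s) *v (Ad *v g s))
    + integral {-h..0} (\<lambda>u. (Ad *v g u) \<bullet>
        (Y (u + h) *v x 0 + integral {-h..0} (\<lambda>s. lyap_U h A Ad (u - s) *v (Ad *v g s))))"
proof -
  have "integral {-h..0} (\<lambda>s. Z (- s) *v (Ad *v x s)) = integral {-h..0} (\<lambda>s. Z (- s) *v (Ad *v g s))"
    by (rule integral_spike[of "{0}"]) (auto simp: g)
  moreover have "integral {-h..0} delayed_pairing = integral {-h..0} (\<lambda>u. (Ad *v g u) \<bullet>
        (Y (u + h) *v x 0 + integral {-h..0} (\<lambda>s. lyap_U h A Ad (u - s) *v (Ad *v g s))))"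
  proof (rule integral_spike[of "{0}"])
    fix u assume u: "u \<in> {-h..0} - {0}"
    let ?U = "\<lambda>s. lyap_U h A Ad (u - s) *v (Ad *v g s)"
    have left: "(?U has_integral integral {-h..u} (\<lambda>s. Y (u - s) *v (Ad *v x s))) {-h..u}"
      by (rule has_integral_eq[OF _ integrable_integral[OF jump_cont_integrable[OF jump_cont_Y]]])
        (use u in \<open>auto simp: lyap_U_eq g\<close>)
    have right: "(?U has_integral integral {u..0} (\<lambda>s. Z (u + h - s) *v (Ad *v x s))) {u..0}"
      by (rule has_integral_spike_finite[of "{u, 0}", OF _ _ integrable_integral[OF jump_cont_integrable[OF jump_cont_Z]]])
        (use u in \<open>auto simp: lyap_U_eq g algebra_simps\<close>)
    have "integral {-h..0} ?U = integral {-h..u} (\<lambda>s. Y (u - s) *v (Ad *v x s))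
        + integral {u..0} (\<lambda>s. Z (u + h - s) *v (Ad *v x s))"
      by (rule integral_unique[OF has_integral_combine[OF _ _ left right]]) (use u in auto)
    then have "costate (u + h) = Y (u + h) *v x 0 + integral {-h..0} ?U"
      using costate_advance[of 0 "u + h"] u by simp
    then show "(Ad *v g u) \<bullet> (Y (u + h) *v x 0 + integral {-h..0} ?U) = delayed_pairing u"
      using u by (simp add: delayed_pairing_def g)
  qed auto
  ultimately show ?thesis
    by (simp add: costate_def inner_add_right)
qed

end

section \<open>The matrices of the stability test\<close>

lemma continuous_on_lyap_U:
  assumes "invertible (lyap_N h A Ad)"
  shows "continuous_on S (lyap_U h A Ad)"
proof -
  have "continuous_on UNIV (\<lambda>\<tau>. if \<tau> \<le> 0 then lyap_Z h A Ad (h + \<tau>) else lyap_Y h A Ad \<tau>)"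
    by (rule continuous_on_cases_le)
      (auto intro!: continuous_on_lyap_Y continuous_on_compose2[OF continuous_on_lyap_Z[of UNIV]]
        continuous_intros simp: lyap_YZ_boundary[OF assms])
  moreover have "lyap_U h A Ad = (\<lambda>\<tau>. if \<tau> \<le> 0 then lyap_Z h A Ad (h + \<tau>) else lyap_Y h A Ad \<tau>)"
    by (auto simp: lyap_U_eq fun_eq_iff lyap_YZ_boundary[OF assms])
  ultimately show ?thesis
    using continuous_on_subset[of UNIV _ S] by simp
qed

lemma lyap_U_minus:
  assumes "invertible (lyap_N h A Ad)"
  shows "lyap_U h A Ad (- \<tau>) = transpose (lyap_U h A Ad \<tau>)"
proof -
  have Z: "lyap_Z h A Ad \<tau> = transpose (lyap_Y h A Ad (h - \<tau>))" for \<tau>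
    by (rule lyap_Z_eq_transpose_Y[OF assms])
  show ?thesis
    using lyap_YZ_boundary[OF assms] by (auto simp: lyap_U_eq Z transpose_transpose)
qed

lemma continuous_on_legendre [continuous_intros]:
  "continuous_on S f \<Longrightarrow> continuous_on S (\<lambda>x. legendre h k (f x))"
  unfolding legendre_def divide_inverse
  by (intro continuous_on_mult continuous_on_sum continuous_on_power continuous_on_add continuous_on_const)

lemma continuous_on_inner_integral:
  fixes f :: "real \<Rightarrow> real \<Rightarrow> 'a::euclidean_space"
  assumes "continuous_on UNIV (\<lambda>(s, t). f s t)"
  shows "continuous_on S (\<lambda>t. integral {a..b} (\<lambda>s. f s t))"
proof -
  have "continuous_on (S \<times> cbox a b) (\<lambda>(t, s). f s t)"
    using continuous_on_compose2[OF assms, of "S \<times> cbox a b" "\<lambda>(t, s). (s, t)"]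
    by (simp add: case_prod_beta' continuous_intros)
  from integral_continuous_on_param[OF this] show ?thesis by simp
qed

lemma double_integral_linear:
  fixes f :: "real \<Rightarrow> real \<Rightarrow> 'a::euclidean_space" and B :: "'a \<Rightarrow> 'b::euclidean_space"
  assumes "continuous_on UNIV (\<lambda>(s, t). f s t)" "bounded_linear B"
  shows "integral {a..b} (\<lambda>t. integral {a..b} (\<lambda>s. B (f s t)))
    = B (integral {a..b} (\<lambda>t. integral {a..b} (\<lambda>s. f s t)))"
proof -
  have "continuous_on {a..b} (\<lambda>s. f s t)" for t
    using continuous_on_compose2[OF assms(1), of "{a..b}" "\<lambda>s. (s, t)"] by (simp add: continuous_intros)
  then have "integral {a..b} (\<lambda>s. B (f s t)) = B (integral {a..b} (\<lambda>s. f s t))" for t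
    using integral_linear[OF integrable_continuous_real assms(2)] by (simp add: o_def)
  moreover have "integral {a..b} (\<lambda>t. B (integral {a..b} (\<lambda>s. f s t)))
    = B (integral {a..b} (\<lambda>t. integral {a..b} (\<lambda>s. f s t)))"
    using integral_linear[OF integrable_continuous_real[OF continuous_on_inner_integral[OF assms(1)]] assms(2)]
    by (simp add: o_def)
  ultimately show ?thesis by simp
qed

lemma sum_P_index:
  fixes f :: "'m::finite + nat \<times> 'm \<Rightarrow> real"
  shows "(\<Sum>r\<in>P_index n. f r) = (\<Sum>i\<in>UNIV. f (Inl i)) + (\<Sum>k<n. \<Sum>i\<in>UNIV. f (Inr (k, i)))"
proof -
  have "(\<Sum>r\<in>P_index n. f r) = sum f (range Inl) + sum f (Inr ` ({..<n} \<times> UNIV))"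
    unfolding P_index_def by (rule sum.union_disjoint) auto
  also have "sum f (range Inl) = (\<Sum>i\<in>UNIV. f (Inl i))"
    by (subst sum.reindex) auto
  also have "sum f (Inr ` ({..<n} \<times> UNIV)) = (\<Sum>p\<in>{..<n} \<times> UNIV. f (Inr p))"
    by (subst sum.reindex) auto
  finally show ?thesis by (simp add: sum.cartesian_product split_def)
qed

lemma finite_P_index: "finite (P_index n :: ('m::finite + nat \<times> 'm) set)"
  by (simp add: P_index_def)

lemma P_index_mono: "P_index n \<subseteq> P_index (Suc n)"
  by (auto simp: P_index_def)

text \<open>
  A test vector on the smaller index set is extended by zero.
\<close>

lemma pos_def_on_subset:
  assumes "pos_def_on J P" "I \<subseteq> J" "finite J"
  shows "pos_def_on I P"
  unfolding pos_def_on_def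
proof (intro conjI allI impI ballI)
  show "P r c = P c r" if "r \<in> I" "c \<in> I" for r c
    using assms that unfolding pos_def_on_def by blast
  fix v :: "'a \<Rightarrow> real" assume v: "\<exists>r\<in>I. v r \<noteq> 0"
  define u where "u r = (if r \<in> I then v r else 0)" for r
  have "\<exists>r\<in>J. u r \<noteq> 0" using v assms(2) by (auto simp: u_def)
  then have "0 < (\<Sum>r\<in>J. \<Sum>c\<in>J. u r * P r c * u c)"
    using assms(1) unfolding pos_def_on_def by blast
  also have "(\<Sum>r\<in>J. \<Sum>c\<in>J. u r * P r c * u c) = (\<Sum>r\<in>I. \<Sum>c\<in>I. v r * P r c * v c)"
  proof -
    have "(\<Sum>c\<in>J. u r * P r c * u c) = (\<Sum>c\<in>I. u r * P r c * v c)" for r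
      by (rule sum.mono_neutral_cong_right[OF assms(3,2)]) (auto simp: u_def)
    moreover have "(\<Sum>r\<in>J. \<Sum>c\<in>I. u r * P r c * v c) = (\<Sum>r\<in>I. \<Sum>c\<in>I. v r * P r c * v c)"
      by (rule sum.mono_neutral_cong_right[OF assms(3,2)]) (auto simp: u_def)
    ultimately show ?thesis by simp
  qed
  finally show "0 < (\<Sum>r\<in>I. \<Sum>c\<in>I. v r * P r c * v c)" .
qed

lemma bounded_linear_congruence: "bounded_linear (\<lambda>X. P ** X ** Q)"
  for P :: "real^'n^'k" and Q :: "real^'l^'p"
  by (intro bounded_linear_compose[OF bounded_bilinear.bounded_linear_left[OF bounded_bilinear_matrix_matrix_mult]]
      bounded_bilinear.bounded_linear_right[OF bounded_bilinear_matrix_matrix_mult])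

definition T_kernel :: "real \<Rightarrow> real^'m^'m \<Rightarrow> real^'m^'m \<Rightarrow> nat \<Rightarrow> nat \<Rightarrow> real \<Rightarrow> real \<Rightarrow> real^'m^'m" where
  "T_kernel h A Ad k l s t = (legendre h k s * legendre h l t) *\<^sub>R (transpose Ad ** lyap_U h A Ad (s - t) ** Ad)"

lemma T_block_eq:
  "T_block h A Ad k l = integral {-h..0} (\<lambda>t. integral {-h..0} (\<lambda>s. T_kernel h A Ad k l s t))"
  unfolding T_block_def T_kernel_def ell_block_def
  by (intro integral_cong)
    (simp add: transpose_scalar transpose_mat scalar_matrix_assoc[symmetric] matrix_scalar_ac)

lemma continuous_on_T_kernel:
  assumes "invertible (lyap_N h A Ad)"
  shows "continuous_on S (\<lambda>(s, t). T_kernel h A Ad k l s t)"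
  unfolding T_kernel_def case_prod_beta'
  by (intro continuous_intros bounded_linear.continuous_on[OF bounded_linear_congruence]
      continuous_on_compose2[OF continuous_on_lyap_U[OF assms, of UNIV]]) auto

lemma T_kernel_transpose:
  assumes "invertible (lyap_N h A Ad)"
  shows "transpose (T_kernel h A Ad k l s t) = T_kernel h A Ad l k t s"
  using lyap_U_minus[OF assms, of "s - t"]
  by (simp add: T_kernel_def transpose_scalar matrix_transpose_mul transpose_transpose matrix_mul_assoc mult.commute)

text \<open>
  Transposition swaps the arguments of the kernel, by the symmetry of \<open>U\<close>, and the order of the
  integrals can be exchanged because the kernel is continuous.
\<close>

lemma T_block_transpose:
  fixes A Ad :: "real^'m^'m"
  assumes "invertible (lyap_N h A Ad)"
  shows "transpose (T_block h A Ad k l) = T_block h A Ad l k"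
proof -
  have "transpose (T_block h A Ad k l)
      = integral {-h..0} (\<lambda>t. integral {-h..0} (\<lambda>s. transpose (T_kernel h A Ad k l s t)))"
    unfolding T_block_eq
    by (rule double_integral_linear[symmetric, OF continuous_on_T_kernel[OF assms] bounded_linear_transpose])
  also have "\<dots> = integral {-h..0} (\<lambda>t. integral {-h..0} (\<lambda>s. T_kernel h A Ad l k t s))"
    by (simp add: T_kernel_transpose[OF assms])
  also have "\<dots> = integral {-h..0} (\<lambda>s. integral {-h..0} (\<lambda>t. T_kernel h A Ad l k t s))"
    using integral_swap_continuous[of "-h" "-h" 0 0 "\<lambda>t s. T_kernel h A Ad l k t s"]
      continuous_on_T_kernel[OF assms] by simp
  finally show ?thesis by (simp add: T_block_eq)
qed

lemma P_mat_symmetric: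
  assumes "invertible (lyap_N h A Ad)"
  shows "P_mat h A Ad r c = P_mat h A Ad c r"
proof -
  have "lyap_U h A Ad 0 $ i $ j = lyap_U h A Ad 0 $ j $ i" for i j
    using arg_cong[OF lyap_U_minus[OF assms, of 0], of "\<lambda>X. X $ i $ j"] by (simp add: transpose_def)
  moreover have "T_block h A Ad k l $ i $ j = T_block h A Ad l k $ j $ i" for k l i j
    using arg_cong[OF T_block_transpose[OF assms, of k l], of "\<lambda>X. X $ j $ i"] by (simp add: transpose_def)
  moreover have "(Iinv_block h k l :: real^'m^'m) $ i $ j = Iinv_block h l k $ j $ i" for k l and i j :: "'m::finite"
    by (auto simp: Iinv_block_def mat_def)
  ultimately show ?thesis
    by (auto simp: P_mat_def transpose_def split: sum.split prod.split)
qed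

lemma Q_block_eq:
  "Q_block h A Ad k = integral {-h..0} (\<lambda>\<tau>. legendre h k \<tau> *\<^sub>R (transpose (lyap_Y h A Ad (h + \<tau>)) ** Ad))"
  unfolding Q_block_def ell_block_def
  by (intro integral_cong)
    (simp add: lyap_U_eq transpose_scalar transpose_mat matrix_scalar_ac)

lemma bounded_linear_quadratic: "bounded_linear (\<lambda>X. u \<bullet> (X *v v))"
  for u :: "real^'k" and v :: "real^'n"
  by (intro bounded_linear_compose[OF bounded_linear_inner_right]
      bounded_bilinear.bounded_linear_left[OF bounded_bilinear_matrix_vector_mult])

lemma inner_matrix_vector_transpose: "u \<bullet> (X *v v) = (transpose X *v u) \<bullet> v"
  for X :: "real^'n^'k"
  using dot_lmul_matrix[of u X v] by simp

definition legendre_sum :: "real \<Rightarrow> nat \<Rightarrow> (nat \<Rightarrow> real^'m) \<Rightarrow> real \<Rightarrow> real^'m" where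
  "legendre_sum h n c \<tau> = (\<Sum>k<n. legendre h k \<tau> *\<^sub>R c k)"

lemma continuous_on_legendre_sum: "continuous_on S (legendre_sum h n c)"
  unfolding legendre_sum_def[abs_def] by (intro continuous_intros)

lemma sum_Q_block:
  fixes A Ad :: "real^'m^'m"
  shows "(\<Sum>k<n. u \<bullet> (Q_block h A Ad k *v c k)) =
    u \<bullet> integral {-h..0} (\<lambda>\<tau>. transpose (lyap_Y h A Ad (h + \<tau>)) *v (Ad *v legendre_sum h n c \<tau>))"
proof -
  let ?K = "\<lambda>\<tau>. transpose (lyap_Y h A Ad (h + \<tau>)) ** Ad"
  have cK: "continuous_on S ?K" for S
    by (intro bounded_bilinear.continuous_on[OF bounded_bilinear_matrix_matrix_mult]
        bounded_linear.continuous_on[OF bounded_linear_transpose] continuous_on_const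
        continuous_on_compose2[OF continuous_on_lyap_Y[of UNIV]] continuous_intros) auto
  have cl: "continuous_on {-h..0} (\<lambda>\<tau>. legendre h k \<tau> *\<^sub>R ?K \<tau>)" for k
    by (intro continuous_intros cK)
  have "u \<bullet> (Q_block h A Ad k *v c k) = integral {-h..0} (\<lambda>\<tau>. u \<bullet> (?K \<tau> *v (legendre h k \<tau> *\<^sub>R c k)))" for k
    using integral_linear[OF integrable_continuous_real[OF cl[of k]] bounded_linear_quadratic[of u "c k"]]
    by (simp add: Q_block_eq o_def scaleR_matrix_vector_assoc[symmetric] matrix_vector_mult_scaleR)
  then have "(\<Sum>k<n. u \<bullet> (Q_block h A Ad k *v c k))
      = (\<Sum>k<n. integral {-h..0} (\<lambda>\<tau>. u \<bullet> (?K \<tau> *v (legendre h k \<tau> *\<^sub>R c k))))" by simp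
  also have "\<dots> = integral {-h..0} (\<lambda>\<tau>. \<Sum>k<n. u \<bullet> (?K \<tau> *v (legendre h k \<tau> *\<^sub>R c k)))"
    by (intro integral_sum[symmetric] integrable_continuous_real continuous_on_inner continuous_on_const
        bounded_bilinear.continuous_on[OF bounded_bilinear_matrix_vector_mult] cK continuous_intros) auto
  also have "\<dots> = integral {-h..0} (\<lambda>\<tau>. u \<bullet> (?K \<tau> *v legendre_sum h n c \<tau>))"
    by (simp add: legendre_sum_def inner_sum_right[symmetric]
        bounded_bilinear.sum_right[OF bounded_bilinear_matrix_vector_mult, symmetric])
  also have "\<dots> = u \<bullet> integral {-h..0} (\<lambda>\<tau>. ?K \<tau> *v legendre_sum h n c \<tau>)"
  proof -
    have "continuous_on {-h..0} (\<lambda>\<tau>. ?K \<tau> *v legendre_sum h n c \<tau>)"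
      by (intro bounded_bilinear.continuous_on[OF bounded_bilinear_matrix_vector_mult] cK continuous_on_legendre_sum)
    from integral_linear[OF integrable_continuous_real[OF this] bounded_linear_inner_right[of u]]
    show ?thesis by (simp add: o_def)
  qed
  finally show ?thesis by (simp add: matrix_vector_mul_assoc)
qed

lemma sum_T_block:
  fixes A Ad :: "real^'m^'m"
  assumes "invertible (lyap_N h A Ad)"
  shows "(\<Sum>k<n. \<Sum>l<n. c k \<bullet> (T_block h A Ad k l *v c l)) =
    integral {-h..0} (\<lambda>t. integral {-h..0} (\<lambda>s.
      (Ad *v legendre_sum h n c s) \<bullet> (lyap_U h A Ad (s - t) *v (Ad *v legendre_sum h n c t))))"
proof -
  let ?F = "\<lambda>k l s t. c k \<bullet> (T_kernel h A Ad k l s t *v c l)"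
  have cont: "continuous_on UNIV (\<lambda>(s, t). ?F k l s t)" for k l
    using bounded_linear.continuous_on[OF bounded_linear_quadratic[of "c k" "c l"]
        continuous_on_T_kernel[OF assms, of UNIV k l]]
    by (simp add: case_prod_beta')
  have cont1: "continuous_on {-h..0} (\<lambda>s. ?F k l s t)" for k l t
    using continuous_on_compose2[OF cont[of k l], of "{-h..0}" "\<lambda>s. (s, t)"] by (simp add: continuous_intros)
  have "(\<Sum>k<n. \<Sum>l<n. c k \<bullet> (T_block h A Ad k l *v c l))
      = (\<Sum>k<n. \<Sum>l<n. integral {-h..0} (\<lambda>t. integral {-h..0} (\<lambda>s. ?F k l s t)))"
    unfolding T_block_eq
      double_integral_linear[OF continuous_on_T_kernel[OF assms] bounded_linear_quadratic] ..
  also have "\<dots> = integral {-h..0} (\<lambda>t. \<Sum>k<n. \<Sum>l<n. integral {-h..0} (\<lambda>s. ?F k l s t))"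
    using continuous_on_inner_integral[OF cont]
    by (simp add: integral_sum integrable_sum integrable_continuous_real)
  also have "\<dots> = integral {-h..0} (\<lambda>t. integral {-h..0} (\<lambda>s. \<Sum>k<n. \<Sum>l<n. ?F k l s t))"
    using cont1 by (simp add: integral_sum integrable_sum integrable_continuous_real)
  also have "(\<lambda>s t. \<Sum>k<n. \<Sum>l<n. ?F k l s t) = (\<lambda>s t.
      (Ad *v legendre_sum h n c s) \<bullet> (lyap_U h A Ad (s - t) *v (Ad *v legendre_sum h n c t)))"
  proof (intro ext)
    fix s t
    have F: "?F k l s t = (Ad *v (legendre h k s *\<^sub>R c k)) \<bullet> (lyap_U h A Ad (s - t) *v (Ad *v (legendre h l t *\<^sub>R c l)))" for k l
      by (simp add: T_kernel_def scaleR_matrix_vector_assoc[symmetric] matrix_vector_mult_scaleR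
          matrix_vector_mul_assoc[symmetric] inner_matrix_vector_transpose[of "c k" "transpose Ad"]
          transpose_transpose del: transpose_matrix_vector)
    show "(\<Sum>k<n. \<Sum>l<n. ?F k l s t) =
      (Ad *v legendre_sum h n c s) \<bullet> (lyap_U h A Ad (s - t) *v (Ad *v legendre_sum h n c t))"
      unfolding F legendre_sum_def
      by (simp only: bounded_bilinear.sum_right[OF bounded_bilinear_matrix_vector_mult] inner_sum_left inner_sum_right)
        (rule sum.swap)
  qed
  finally show ?thesis by meson
qed

lemma P_mat_quadratic_form:
  fixes A Ad :: "real^'m^'m" and v :: "'m + nat \<times> 'm \<Rightarrow> real"
  defines "v0 \<equiv> \<chi> i. v (Inl i)" and "c \<equiv> \<lambda>k. \<chi> i. v (Inr (k, i))"
  shows "(\<Sum>r\<in>P_index n. \<Sum>s\<in>P_index n. v r * P_mat h A Ad r s * v s) =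
    v0 \<bullet> (lyap_U h A Ad 0 *v v0) + 2 * (\<Sum>k<n. v0 \<bullet> (Q_block h A Ad k *v c k))
    + (\<Sum>k<n. \<Sum>l<n. c k \<bullet> (T_block h A Ad k l *v c l))
    + (\<Sum>k<n. h / (2 * real k + 1) * (c k \<bullet> c k))"
proof -
  have form: "(\<Sum>i\<in>UNIV. \<Sum>j\<in>UNIV. a $ i * X $ i $ j * b $ j) = a \<bullet> (X *v b)"
    for X :: "real^'m^'m" and a b
    by (simp add: inner_vec_def matrix_vector_mult_def sum_distrib_left mult.assoc)
  have Iinv: "(\<Sum>l<n. c k \<bullet> (Iinv_block h k l *v c l)) = h / (2 * real k + 1) * (c k \<bullet> c k)" if "k < n" for k
  proof -
    have "(\<Sum>l<n. c k \<bullet> (Iinv_block h k l *v c l)) = (\<Sum>l<n. if k = l then h / (2 * real k + 1) * (c k \<bullet> c k) else 0)"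
      by (intro sum.cong refl) (auto simp: Iinv_block_def scaleR_matrix_vector_assoc[symmetric])
    then show ?thesis using that by simp
  qed
  have "(\<Sum>r\<in>P_index n. \<Sum>s\<in>P_index n. v r * P_mat h A Ad r s * v s) =
     (\<Sum>i\<in>UNIV. \<Sum>j\<in>UNIV. v0 $ i * lyap_U h A Ad 0 $ i $ j * v0 $ j)
   + (\<Sum>i\<in>UNIV. \<Sum>l<n. \<Sum>j\<in>UNIV. v0 $ i * Q_block h A Ad l $ i $ j * c l $ j)
   + ((\<Sum>k<n. \<Sum>i\<in>UNIV. \<Sum>j\<in>UNIV. c k $ i * transpose (Q_block h A Ad k) $ i $ j * v0 $ j)
   + (\<Sum>k<n. \<Sum>i\<in>UNIV. \<Sum>l<n. \<Sum>j\<in>UNIV.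
        c k $ i * (T_block h A Ad k l + Iinv_block h k l) $ i $ j * c l $ j))"
    by (simp add: sum_P_index P_mat_def v0_def c_def sum.distrib)
  also have "(\<Sum>i\<in>UNIV. \<Sum>l<n. \<Sum>j\<in>UNIV. v0 $ i * Q_block h A Ad l $ i $ j * c l $ j)
      = (\<Sum>l<n. \<Sum>i\<in>UNIV. \<Sum>j\<in>UNIV. v0 $ i * Q_block h A Ad l $ i $ j * c l $ j)"
    by (rule sum.swap)
  also have "(\<Sum>k<n. \<Sum>i\<in>UNIV. \<Sum>l<n. \<Sum>j\<in>UNIV.
        c k $ i * (T_block h A Ad k l + Iinv_block h k l) $ i $ j * c l $ j)
      = (\<Sum>k<n. \<Sum>l<n. \<Sum>i\<in>UNIV. \<Sum>j\<in>UNIV.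
        c k $ i * (T_block h A Ad k l + Iinv_block h k l) $ i $ j * c l $ j)"
    by (intro sum.cong refl sum.swap)
  also have "(\<Sum>k<n. \<Sum>l<n. \<Sum>i\<in>UNIV. \<Sum>j\<in>UNIV.
        c k $ i * (T_block h A Ad k l + Iinv_block h k l) $ i $ j * c l $ j)
      = (\<Sum>k<n. \<Sum>l<n. c k \<bullet> (T_block h A Ad k l *v c l))
        + (\<Sum>k<n. h / (2 * real k + 1) * (c k \<bullet> c k))"
    unfolding form by (simp add: matrix_vector_mult_add_rdistrib inner_add_right sum.distrib Iinv)
  also have "(\<Sum>k<n. \<Sum>i\<in>UNIV. \<Sum>j\<in>UNIV. c k $ i * transpose (Q_block h A Ad k) $ i $ j * v0 $ j)
      = (\<Sum>k<n. v0 \<bullet> (Q_block h A Ad k *v c k))"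
    unfolding form by (simp add: inner_matrix_vector_transpose[of v0] inner_commute)
  finally show ?thesis unfolding form by simp
qed

section \<open>Stability implies positive definiteness\<close>

text \<open>
  The blocks \<open>U(0)\<close>, \<open>\<^bold>Q\<^sub>n\<close> and \<open>\<^bold>T\<^sub>n\<close> together reproduce the initial energy of the
  trajectory whose history has the Legendre coefficients \<open>c\<close>. The term linear in the
  history occurs twice: once from the costate at time \<open>0\<close>, once from the pairing over \<open>[0, h]\<close>.
\<close>

lemma (in dde_trajectory) P_mat_quadratic_form_eq_energy:
  fixes v :: "'m + nat \<times> 'm \<Rightarrow> real"
  defines "c \<equiv> \<lambda>k. \<chi> i. v (Inr (k, i))"
  assumes "x 0 = (\<chi> i. v (Inl i))" and g: "\<And>t. t < 0 \<Longrightarrow> x t = legendre_sum h n c t"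
  shows "(\<Sum>r\<in>P_index n. \<Sum>s\<in>P_index n. v r * P_mat h A Ad r s * v s) =
    x 0 \<bullet> costate 0 + integral {-h..0} delayed_pairing
    + (\<Sum>k<n. h / (2 * real k + 1) * (c k \<bullet> c k))"
proof -
  let ?g = "legendre_sum h n c" and ?U = "lyap_U h A Ad"
  let ?q = "x 0 \<bullet> integral {-h..0} (\<lambda>\<tau>. transpose (Y (h + \<tau>)) *v (Ad *v ?g \<tau>))"
  let ?t = "integral {-h..0} (\<lambda>t. integral {-h..0} (\<lambda>s. (Ad *v ?g s) \<bullet> (?U (s - t) *v (Ad *v ?g t))))"
  have Z: "Z (- s) = transpose (Y (h + s))" for s
    using lyap_Z_eq_transpose_Y[OF N_invertible, of "- s"] by simp
  have cg: "continuous_on S (\<lambda>s. Ad *v ?g s)" for S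
    by (intro bounded_linear.continuous_on[OF matrix_vector_mul_bounded_linear] continuous_on_legendre_sum)
  have cY: "continuous_on {-h..0} (\<lambda>\<tau>. transpose (Y (h + \<tau>)) *v (Ad *v ?g \<tau>))"
    by (intro bounded_bilinear.continuous_on[OF bounded_bilinear_matrix_vector_mult]
        bounded_linear.continuous_on[OF bounded_linear_transpose] cg
        continuous_on_compose2[OF continuous_on_lyap_Y[of UNIV]] continuous_intros) auto
  have cU: "continuous_on UNIV (\<lambda>(s, t). (Ad *v ?g s) \<bullet> (?U (s - t) *v (Ad *v ?g t)))"
    unfolding case_prod_beta'
    by (intro continuous_on_inner bounded_bilinear.continuous_on[OF bounded_bilinear_matrix_vector_mult]
        continuous_on_compose2[OF cg[of UNIV]]
        continuous_on_compose2[OF continuous_on_lyap_U[OF N_invertible, of UNIV]] continuous_intros) auto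
  have "integral {-h..0} (\<lambda>u. (Ad *v ?g u) \<bullet>
        (Y (u + h) *v x 0 + integral {-h..0} (\<lambda>s. ?U (u - s) *v (Ad *v ?g s)))) = ?q + ?t"
  proof -
    have "(Ad *v ?g u) \<bullet> (Y (u + h) *v x 0) = x 0 \<bullet> (transpose (Y (h + u)) *v (Ad *v ?g u))" for u
      by (simp only: inner_matrix_vector_transpose[of "Ad *v ?g u" "Y (h + u)"] inner_commute[of "x 0"]
          add.commute[of u h])
    moreover have "(Ad *v ?g u) \<bullet> integral {-h..0} (\<lambda>s. ?U (u - s) *v (Ad *v ?g s))
        = integral {-h..0} (\<lambda>s. (Ad *v ?g s) \<bullet> (?U (s - u) *v (Ad *v ?g u)))" for u
    proof -
      have "continuous_on {-h..0} (\<lambda>s. ?U (u - s) *v (Ad *v ?g s))"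
        by (intro bounded_bilinear.continuous_on[OF bounded_bilinear_matrix_vector_mult] cg
            continuous_on_compose2[OF continuous_on_lyap_U[OF N_invertible, of UNIV]] continuous_intros) auto
      from integral_linear[OF integrable_continuous_real[OF this] bounded_linear_inner_right[of "Ad *v ?g u"]]
      have "(Ad *v ?g u) \<bullet> integral {-h..0} (\<lambda>s. ?U (u - s) *v (Ad *v ?g s))
          = integral {-h..0} (\<lambda>s. (Ad *v ?g u) \<bullet> (?U (u - s) *v (Ad *v ?g s)))"
        by (simp add: o_def)
      moreover have "(Ad *v ?g u) \<bullet> (?U (u - s) *v (Ad *v ?g s)) = (Ad *v ?g s) \<bullet> (?U (s - u) *v (Ad *v ?g u))" for s
      proof -
        have "transpose (?U (u - s)) = ?U (s - u)"
          using lyap_U_minus[OF N_invertible, of "u - s"] by simp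
        then show ?thesis
          by (simp only: inner_matrix_vector_transpose[of "Ad *v ?g u" "?U (u - s)"] inner_commute[of "Ad *v ?g s"])
      qed
      ultimately show ?thesis by simp
    qed
    ultimately have "integral {-h..0} (\<lambda>u. (Ad *v ?g u) \<bullet>
        (Y (u + h) *v x 0 + integral {-h..0} (\<lambda>s. ?U (u - s) *v (Ad *v ?g s))))
      = integral {-h..0} (\<lambda>u. x 0 \<bullet> (transpose (Y (h + u)) *v (Ad *v ?g u))
          + integral {-h..0} (\<lambda>s. (Ad *v ?g s) \<bullet> (?U (s - u) *v (Ad *v ?g u))))"
      by (simp add: inner_add_right del: transpose_matrix_vector)
    also have "\<dots> = integral {-h..0} (\<lambda>u. x 0 \<bullet> (transpose (Y (h + u)) *v (Ad *v ?g u))) + ?t"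
      by (intro Henstock_Kurzweil_Integration.integral_add integrable_continuous_real continuous_on_inner_integral cU
          continuous_on_inner continuous_on_const cY)
    also have "integral {-h..0} (\<lambda>u. x 0 \<bullet> (transpose (Y (h + u)) *v (Ad *v ?g u))) = ?q"
      using integral_linear[OF integrable_continuous_real[OF cY] bounded_linear_inner_right[of "x 0"]]
      by (simp add: o_def del: transpose_matrix_vector)
    finally show ?thesis .
  qed
  then have "x 0 \<bullet> costate 0 + integral {-h..0} delayed_pairing = x 0 \<bullet> (?U 0 *v x 0) + 2 * ?q + ?t"
    by (simp add: initial_energy_eq[OF g] Z lyap_U_eq[of h A Ad 0] del: transpose_matrix_vector)
  then show ?thesis
    unfolding P_mat_quadratic_form assms(2)[symmetric] c_def[symmetric] sum_Q_block sum_T_block[OF N_invertible]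
    by (simp add: c_def)
qed

text \<open>
  A function with a jump at \<open>0\<close> is an admissible initial function, because only the left limit
  there has to exist; so the stability estimate applies to its solution.
\<close>

lemma stable_solution_tendsto_zero:
  fixes A Ad :: "real^'m^'m"
  assumes "exponentially_stable h A Ad" "0 < h" and jc: "jump_cont x"
    and der: "\<And>t. 0 < t \<Longrightarrow> t \<noteq> h \<Longrightarrow> (x has_vector_derivative A *v x t + Ad *v x (t - h)) (at t)"
  shows "(x \<longlongrightarrow> 0) at_top"
proof -
  obtain g where g: "continuous_on UNIV g" "\<And>s. s < 0 \<Longrightarrow> x s = g s" and x: "continuous_on {0..} x"
    using jc unfolding jump_cont_def by blast
  have "piecewise_continuous (-h) 0 x"
    unfolding piecewise_continuous_def
  proof (intro exI[of _ "{0}"] conjI ballI)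
    show "continuous_on ({-h..0} - {0}) x"
      by (rule continuous_on_eq[of _ g]) (use g in \<open>auto intro: continuous_on_subset\<close>)
    fix s :: real assume "s \<in> {0}"
    have "(g \<longlongrightarrow> g 0) (at 0 within {-h..<0})"
    proof (rule tendsto_within_subset[OF _ subset_UNIV])
      show "g \<midarrow>0\<rightarrow> g 0"
        using g(1) by (simp add: continuous_on_eq_continuous_at isCont_def)
    qed
    then have "(x \<longlongrightarrow> g 0) (at 0 within {-h..<0})"
      by (rule Lim_transform_within[OF _ zero_less_one]) (auto simp: g)
    then show "\<exists>L. (x \<longlongrightarrow> L) (at s within {-h..<s})"
      using \<open>s \<in> {0}\<close> by auto
    show "\<exists>R. (x \<longlongrightarrow> R) (at s within {s<..0})"
      using \<open>s \<in> {0}\<close> by simp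
  qed (use assms(2) in auto)
  moreover have "is_solution h A Ad x x"
  proof -
    have "\<forall>t\<in>{0..} - {0, h}.
        (x has_vector_derivative A *v x t + Ad *v x (t - h)) (at t within {0..})"
      using der by (simp add: has_vector_derivative_at_within)
    moreover have "finite {0, h}" by simp
    ultimately show ?thesis
      unfolding is_solution_def using x by blast
  qed
  moreover obtain \<kappa> \<alpha> where "0 < \<alpha>" and stable: "\<And>\<phi> x t. piecewise_continuous (-h) 0 \<phi> \<Longrightarrow>
      is_solution h A Ad \<phi> x \<Longrightarrow> 0 \<le> t \<Longrightarrow>
      segment_norm h x t \<le> \<kappa> * exp (- \<alpha> * t) * segment_norm h x 0"
    using assms(1) unfolding exponentially_stable_def by metis
  ultimately have stable: "segment_norm h x t \<le> \<kappa> * exp (- \<alpha> * t) * segment_norm h x 0" if "0 \<le> t" for t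
    using that by blast
  have bound: "norm (x t) \<le> \<kappa> * segment_norm h x 0 * exp (- \<alpha> * t)" if "h \<le> t" for t
  proof -
    have "compact ((\<lambda>\<tau>. norm (x (t + \<tau>))) ` {-h..0})"
      using that
      by (intro compact_continuous_image continuous_on_norm continuous_on_compose2[OF x] continuous_intros) auto
    then have "bdd_above ((\<lambda>\<tau>. norm (x (t + \<tau>))) ` {-h..0})"
      by (simp add: bounded_imp_bdd_above compact_imp_bounded)
    then have "norm (x (t + 0)) \<le> segment_norm h x t"
      unfolding segment_norm_def by (rule cSUP_upper2[where x = 0]) (use assms(2) in auto)
    with stable[of t] that assms(2) show ?thesis by (simp add: mult_ac)
  qed
  have "((\<lambda>t. \<kappa> * segment_norm h x 0 * exp (- \<alpha> * t)) \<longlongrightarrow> 0) at_top"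
  proof -
    have "filterlim (\<lambda>t. - \<alpha> * t) at_bot at_top"
      using filterlim_tendsto_neg_mult_at_bot[OF tendsto_const _ filterlim_ident, of "- \<alpha>"] \<open>0 < \<alpha>\<close> by simp
    from tendsto_mult_right_zero[OF filterlim_compose[OF exp_at_bot this]] show ?thesis .
  qed
  moreover have "\<forall>\<^sub>F t in at_top. norm (x t) \<le> \<kappa> * segment_norm h x 0 * exp (- \<alpha> * t)"
    using eventually_ge_at_top[of h] by eventually_elim (rule bound)
  ultimately show ?thesis
    by (rule Lim_null_comparison[rotated])
qed

lemma stable_imp_P_mat_pos_def:
  fixes A Ad :: "real^'m^'m"
  assumes "0 < h" "invertible (lyap_N h A Ad)" "exponentially_stable h A Ad"
  shows "pos_def_on (P_index n) (P_mat h A Ad)"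
  unfolding pos_def_on_def
proof (intro conjI ballI allI impI)
  show "P_mat h A Ad r c = P_mat h A Ad c r" for r c
    by (rule P_mat_symmetric[OF assms(2)])
  fix v :: "'m + nat \<times> 'm \<Rightarrow> real" assume "\<exists>r\<in>P_index n. v r \<noteq> 0"
  then obtain r where r: "r \<in> P_index n" "v r \<noteq> 0" by blast
  define c where "c k = (\<chi> i. v (Inr (k, i)))" for k
  obtain x where jc: "jump_cont x" and g: "\<And>t. t < 0 \<Longrightarrow> x t = legendre_sum h n c t"
    and x0: "x 0 = (\<chi> i. v (Inl i))"
    and der: "\<And>t. 0 < t \<Longrightarrow> t \<noteq> h \<Longrightarrow> (x has_vector_derivative A *v x t + Ad *v x (t - h)) (at t)"
    using dde_solution_exists[OF assms(1) continuous_on_legendre_sum] by metis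
  interpret dde_trajectory h A Ad x
    by unfold_locales (use assms jc der in auto)
  have lim: "(x \<longlongrightarrow> 0) at_top"
    by (rule stable_solution_tendsto_zero[OF assms(3,1) jc der])
  let ?V = "x 0 \<bullet> costate 0 + integral {-h..0} delayed_pairing"
    and ?S = "\<Sum>k<n. h / (2 * real k + 1) * (c k \<bullet> c k)"
  have S: "0 \<le> ?S" using assms(1) by (intro sum_nonneg mult_nonneg_nonneg) auto
  have "0 < ?V + ?S"
  proof (cases r)
    case (Inl i)
    then have "x 0 \<noteq> 0" using r(2) by (auto simp: x0 vec_eq_iff)
    then show ?thesis using initial_energy_nonneg(2)[OF lim] S by linarith
  next
    case (Inr p)
    then obtain k i where k: "r = Inr (k, i)" "k < n" using r(1) by (auto simp: P_index_def)
    then have "c k \<noteq> 0" using r(2) by (auto simp: c_def vec_eq_iff)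
    then have "0 < h / (2 * real k + 1) * (c k \<bullet> c k)" using assms(1) by simp
    also have "\<dots> \<le> ?S"
      using k(2) assms(1) by (intro member_le_sum) auto
    finally show ?thesis using initial_energy_nonneg(1)[OF lim] by linarith
  qed
  also have "?V + ?S = (\<Sum>r\<in>P_index n. \<Sum>s\<in>P_index n. v r * P_mat h A Ad r s * v s)"
    using P_mat_quadratic_form_eq_energy[of v n] x0 g by (simp add: c_def[abs_def])
  finally show "0 < (\<Sum>r\<in>P_index n. \<Sum>s\<in>P_index n. v r * P_mat h A Ad r s * v s)" .
qed

theorem corollary1:
  fixes A Ad :: "real^'m^'m" and h :: real
  assumes "0 < h"
    and "invertible (lyap_N h A Ad)"
  shows "((\<exists>n. \<not> pos_def_on (P_index n) (P_mat h A Ad)) \<longrightarrow> \<not> exponentially_stable h A Ad) \<and>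
         (\<forall>n. \<not> pos_def_on (P_index n) (P_mat h A Ad) \<longrightarrow>
              \<not> pos_def_on (P_index (Suc n)) (P_mat h A Ad))"
proof (intro conjI impI allI notI)
  assume "\<exists>n. \<not> pos_def_on (P_index n) (P_mat h A Ad)" and "exponentially_stable h A Ad"
  then show False using stable_imp_P_mat_pos_def[OF assms] by blast
next
  fix n
  assume "\<not> pos_def_on (P_index n) (P_mat h A Ad)" and "pos_def_on (P_index (Suc n)) (P_mat h A Ad)"
  then show False using pos_def_on_subset[OF _ P_index_mono finite_P_index] by metis
qed

end
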